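(* Let $d\geq 1$, let $1<p<q<\infty$, and let $s>0$ be given by $e^{2s} = \frac{q-1}{p-1}$. Let $g:\mathbb{R}^d\to[0,\infty)$ be a measurable, bounded and compactly supported function which is not almost everywhere zero, and let $u$ be the solution of $\partial_t u = Lu$ on $(0,\infty)\times\mathbb{R}^d$ with initial data $g$, that is, $u(t,x) = e^{tL}g(x)$ for $t>0$, $x\in\mathbb{R}^d$. Let $Q:(0,\infty)\to(0,\infty)$ be given by $$Q(t) = \int_{\mathbb{R}^d} \left(e^{sL}(u(t,\cdot)^{1/p})\right)^q(x)\,\mathrm{d}\gamma(x).$$ Then $Q$ is nondecreasing on $(0,\infty)$.
   Context: $\gamma$ denotes the standard gaussian probability measure on $\mathbb{R}^d$, $\mathrm{d}\gamma(y) = e^{-\frac12|y|^2}\frac{\mathrm{d}y}{(2\pi)^{d/2}}$. The Ornstein--Uhlenbeck semigroup $(e^{sL})_{s\geq 0}$ is defined by $$e^{sL}f(x) = \int_{\mathbb{R}^d} f\big(e^{-s}x + (1-e^{-2s})^{1/2}y\big)\,\mathrm{d}\gamma(y),$$ and its generator is $Lf(x) = \Delta f(x) - x\cdot\nabla f(x)$ (acting in the spatial variable $x$). *)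

theory Defs
  imports "HOL-Analysis.Analysis"
begin

text \<open>The measure lives on the Lebesgue sigma-algebra, so that Lebesgue measurable
  integrands are not silently integrated to 0.\<close>

definition gaussian :: "'a::euclidean_space measure" where
  "gaussian = density lebesgue
     (\<lambda>y. ennreal (exp (- (1 / 2) * (norm y)\<^sup>2) / (2 * pi) powr (real DIM('a) / 2)))"

definition ornstein_uhlenbeck :: "real \<Rightarrow> ('a::euclidean_space \<Rightarrow> real) \<Rightarrow> 'a \<Rightarrow> real" where
  "ornstein_uhlenbeck s f x =
     (\<integral>y. f (exp (- s) *\<^sub>R x + sqrt (1 - exp (- 2 * s)) *\<^sub>R y) \<partial>gaussian)"

end

theory Submission
  imports Defs "HOL-Probability.Distributions"
begin

text \<open>The idea is to prove the pointwise inequality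
  \<open>e\<^sup>h\<^sup>L ((e\<^sup>s\<^sup>L v\<^sup>1\<^sup>/\<^sup>p)\<^sup>q) \<le> (e\<^sup>s\<^sup>L ((e\<^sup>h\<^sup>L v)\<^sup>1\<^sup>/\<^sup>p))\<^sup>q\<close> and to integrate it against
  the invariant Gaussian measure with \<open>v = u(t) + \<epsilon>\<close>, \<open>\<epsilon> \<rightarrow> 0\<close>. Splitting the Gaussian noise
  reduces it to hypercontractivity in its two-function form
  \<open>E [F(X)\<^sup>\<alpha> G(Y)\<^sup>\<beta>] \<le> (E F)\<^sup>\<alpha> (E G)\<^sup>\<beta>\<close>, for standard Gaussian vectors \<open>X\<close>, \<open>Y\<close> with
  correlation \<open>\<rho> = e\<^sup>-\<^sup>s\<close>, \<open>\<alpha> = 1/p\<close> and \<open>\<beta> = 1 - 1/q\<close>. The latter holds because the left-hand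
  side increases to the right-hand side when \<open>F\<close> and \<open>G\<close> evolve under the heat flow while the
  remaining noise shrinks: the second-order term of one time step is a quadratic form which is
  negative semidefinite exactly when \<open>\<rho>\<^sup>2 \<alpha> \<beta> \<le> (1 - \<alpha>) (1 - \<beta>)\<close>. The flow is discretised in steps
  of length \<open>h\<close>, each costing \<open>O(h\<^sup>3\<^sup>/\<^sup>2)\<close>, so that no derivatives under the integral are needed.\<close>

subsection \<open>The standard Gaussian measure on the Borel sets\<close>

text \<open>At a fixed point the left-hand side is T = E[H(Y)^q], where H is e^(sL) v^(1/p) along
  the noise Y. Writing H^q = H * (H^q)^\<beta>, as in duality for the L^q norm, explains both
  \<beta> = 1 - 1/q and the choice G = H^q. The first factor H is itself an average of v^(1/p). The
  part of its noise that also occurs on the right is held fixed, the two-function inequality bounds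
  the rest by a power of T, and T cancels down to T^(1/q). For the prescribed s the condition on
  \<rho>, \<alpha>, \<beta> holds with equality.

  In one time step each function is compared with its value after the step, which is the mean of the
  values before it. Relative increments then average to zero exactly, and only quadratic terms
  remain to be controlled. Two uniformity demands shape the rest. Relative increments need functions
  bounded away from 0, hence the shift \<epsilon>. The error constant must be the same for all
  steps, hence an initial smoothing time \<tau>, removed at the end by continuity.\<close>

definition gauss_density :: "'a::euclidean_space \<Rightarrow> real" where
  "gauss_density y = exp (- (1 / 2) * (norm y)\<^sup>2) / (2 * pi) powr (real DIM('a) / 2)"

text \<open>Built on \<open>lborel\<close> rather than \<open>lebesgue\<close>, since product
  measures, image measures and the measurability prover work on Borel sets. Borel integrands have
  the same integral under \<open>gaussian\<close>, by
  \<open>integral_gaussian_borel\<close>.\<close>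

definition borel_gaussian :: "'a::euclidean_space measure" where
  "borel_gaussian = density lborel (\<lambda>y. ennreal (gauss_density y))"

lemma gauss_density_pos [simp]: "0 < gauss_density y"
  by (simp add: gauss_density_def)

lemma gauss_density_nonneg [simp]: "0 \<le> gauss_density y"
  by (simp add: less_imp_le)

lemma gauss_density_measurable [measurable]: "gauss_density \<in> borel_measurable borel"
  unfolding gauss_density_def by measurable

lemma sets_borel_gaussian [simp, measurable_cong]: "sets borel_gaussian = sets borel"
  by (simp add: borel_gaussian_def)

lemma space_borel_gaussian [simp]: "space borel_gaussian = UNIV"
  by (simp add: borel_gaussian_def)

text \<open>Factorisation over coordinates reduces the total mass to that of the one-dimensional
  normal density.\<close>

lemma gauss_density_prod:
  fixes y :: "'a::euclidean_space"
  shows "gauss_density y = (\<Prod>b\<in>Basis. std_normal_density (y \<bullet> b))"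
proof -
  have "(\<Prod>b\<in>(Basis::'a set). sqrt (2 * pi)) = (2 * pi) powr (real DIM('a) / 2)"
  proof -
    have "(2 * pi) powr (real DIM('a) / 2) = ((2 * pi) powr (1 / 2)) powr real DIM('a)"
      by (simp only: powr_powr) simp
    also have "\<dots> = sqrt (2 * pi) ^ DIM('a)"
      by (simp add: powr_half_sqrt powr_realpow)
    finally show ?thesis by simp
  qed
  moreover have "exp (- (1 / 2) * (norm y)\<^sup>2) = (\<Prod>b\<in>Basis. exp (- (y \<bullet> b)\<^sup>2 / 2))"
    unfolding power2_norm_eq_inner euclidean_inner[of y y]
    by (simp add: exp_sum[symmetric] sum_divide_distrib[symmetric] sum_negf power2_eq_square)
  ultimately show ?thesis
    by (simp add: gauss_density_def std_normal_density_def prod_dividef)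
qed

lemma nn_integral_gauss_density: "(\<integral>\<^sup>+y. gauss_density (y::'a::euclidean_space) \<partial>lborel) = 1"
proof -
  have "(\<integral>\<^sup>+x. normal_density 0 1 x \<partial>lborel) = 1"
    by (subst nn_integral_eq_integral) auto
  then have "(\<integral>\<^sup>+y. (\<Prod>b\<in>Basis. ennreal (std_normal_density ((y::'a) \<bullet> b))) \<partial>lborel) = 1"
    by (subst nn_integral_lborel_prod) auto
  then show ?thesis
    by (simp add: gauss_density_prod prod_ennreal)
qed

interpretation borel_gaussian: prob_space "borel_gaussian :: 'a::euclidean_space measure"
  by standard
    (simp add: borel_gaussian_def emeasure_density nn_integral_gauss_density cong: nn_integral_cong)

section \<open>Affine substitutions and rotation invariance\<close>

lemma nn_integral_lborel_affine:
  fixes f :: "'a::euclidean_space \<Rightarrow> ennreal"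
  assumes [measurable]: "f \<in> borel_measurable borel" and "c \<noteq> 0"
  shows "(\<integral>\<^sup>+x. f x \<partial>lborel) = (\<integral>\<^sup>+x. f (t + c *\<^sub>R x) * \<bar>c\<bar> ^ DIM('a) \<partial>lborel)"
  by (subst lborel_affine[OF \<open>c \<noteq> 0\<close>, of t])
     (simp add: nn_integral_density nn_integral_distr mult.commute)

text \<open>\<open>P\<close> need not be measurable, so the argument runs on a Borel null set
  \<open>N\<close> containing the exceptional set.\<close>

lemma AE_lborel_affine:
  fixes t :: "'a::euclidean_space"
  assumes "AE x in lborel. P x" and "c \<noteq> 0"
  shows "AE x in lborel. P (t + c *\<^sub>R x)"
proof -
  obtain N where N: "{x. \<not> P x} \<subseteq> N" "N \<in> sets lborel" "emeasure lborel N = 0"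
    using assms(1) by (auto elim!: AE_E)
  have "AE x in lborel. x \<notin> N"
    using N by (auto intro!: AE_not_in simp: null_sets_def)
  then have "AE x in density (distr lborel borel (\<lambda>x. t + c *\<^sub>R x)) (\<lambda>_. \<bar>c\<bar>^DIM('a)). x \<notin> N"
    unfolding lborel_affine[OF \<open>c \<noteq> 0\<close>, of t, symmetric] .
  then have "AE x in lborel. t + c *\<^sub>R x \<notin> N"
    using N(2) assms(2) by (simp add: AE_density AE_distr_iff)
  then show ?thesis
    by eventually_elim (use N in auto)
qed

text \<open>Completing the square shows that the joint density is symmetric in \<open>y\<close> and \<open>z\<close>.\<close>
lemma gauss_density_exchange:
  fixes y z :: "'a::euclidean_space"
  assumes "\<alpha>\<^sup>2 + \<beta>\<^sup>2 = 1" "0 < \<alpha>"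
  shows "gauss_density (- (\<beta> / \<alpha>) *\<^sub>R y + (1 / \<alpha>) *\<^sub>R z) * gauss_density y =
         gauss_density (- (\<beta> / \<alpha>) *\<^sub>R z + (1 / \<alpha>) *\<^sub>R y) * gauss_density z"
proof -
  have *: "(norm (- (\<beta> / \<alpha>) *\<^sub>R a + (1 / \<alpha>) *\<^sub>R b))\<^sup>2 + (norm a)\<^sup>2 =
      (a \<bullet> a + b \<bullet> b - 2 * \<beta> * (a \<bullet> b)) / \<alpha>\<^sup>2" for a b :: 'a
  proof -
    have "(norm (- (\<beta> / \<alpha>) *\<^sub>R a + (1 / \<alpha>) *\<^sub>R b))\<^sup>2 + (norm a)\<^sup>2 =
       ((\<alpha>\<^sup>2 + \<beta>\<^sup>2) * (a \<bullet> a) + b \<bullet> b - 2 * \<beta> * (a \<bullet> b)) / \<alpha>\<^sup>2"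
      using assms(2) unfolding power2_norm_eq_inner inner_add_left inner_add_right
        inner_scaleR_left inner_scaleR_right
      by (simp add: inner_commute[of b a] field_simps power2_eq_square)
    then show ?thesis using assms(1) by simp
  qed
  have "(norm (- (\<beta> / \<alpha>) *\<^sub>R y + (1 / \<alpha>) *\<^sub>R z))\<^sup>2 + (norm y)\<^sup>2 =
        (norm (- (\<beta> / \<alpha>) *\<^sub>R z + (1 / \<alpha>) *\<^sub>R y))\<^sup>2 + (norm z)\<^sup>2"
    unfolding * by (simp add: inner_commute add.commute)
  then have "- (1 / 2) * (norm (- (\<beta> / \<alpha>) *\<^sub>R y + (1 / \<alpha>) *\<^sub>R z))\<^sup>2 + - (1 / 2) * (norm y)\<^sup>2 =
        - (1 / 2) * (norm (- (\<beta> / \<alpha>) *\<^sub>R z + (1 / \<alpha>) *\<^sub>R y))\<^sup>2 + - (1 / 2) * (norm z)\<^sup>2"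
    by argo
  then show ?thesis
    unfolding gauss_density_def times_divide_times_eq mult_exp_exp by simp
qed

text \<open>With \<open>z = \<alpha> *\<^sub>R x + \<beta> *\<^sub>R y\<close> as the new inner
  variable, the joint density of y and z is symmetric. Exchanging their roles pulls
  \<open>f z\<close> out and leaves a y-integral of total mass 1.\<close>

lemma nn_integral_borel_gaussian_rotate:
  fixes f :: "'a::euclidean_space \<Rightarrow> ennreal"
  assumes [measurable]: "f \<in> borel_measurable borel"
    and ab: "\<alpha>\<^sup>2 + \<beta>\<^sup>2 = 1" "0 < \<alpha>"
  shows "(\<integral>\<^sup>+y. \<integral>\<^sup>+x. f (\<alpha> *\<^sub>R x + \<beta> *\<^sub>R y) \<partial>borel_gaussian \<partial>borel_gaussian) = (\<integral>\<^sup>+z. f z \<partial>borel_gaussian)"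
proof -
  let ?c = "ennreal (\<bar>1 / \<alpha>\<bar> ^ DIM('a))"
  let ?m = "\<lambda>y z. - (\<beta> / \<alpha>) *\<^sub>R y + (1 / \<alpha>) *\<^sub>R (z::'a)"
  have m: "\<alpha> *\<^sub>R ?m y z + \<beta> *\<^sub>R y = z" for y z
    using ab by (simp add: algebra_simps)
  \<comment> \<open>The same substitution with the roles of the variables exchanged; ?c is its
    Jacobian.\<close>
  have one: "(\<integral>\<^sup>+y. gauss_density (?m z y) * ?c \<partial>lborel) = 1" for z
    using nn_integral_lborel_affine[of "\<lambda>x. gauss_density x" "1 / \<alpha>" "- (\<beta> / \<alpha>) *\<^sub>R z"] ab(2)
    by (simp add: nn_integral_gauss_density)
  have "(\<integral>\<^sup>+y. \<integral>\<^sup>+x. f (\<alpha> *\<^sub>R x + \<beta> *\<^sub>R y) \<partial>borel_gaussian \<partial>borel_gaussian)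
     = (\<integral>\<^sup>+y. gauss_density y * (\<integral>\<^sup>+x. gauss_density x * f (\<alpha> *\<^sub>R x + \<beta> *\<^sub>R y) \<partial>lborel) \<partial>lborel)"
    unfolding borel_gaussian_def by (simp add: nn_integral_density)
  also have "\<dots> = (\<integral>\<^sup>+y. gauss_density y *
      (\<integral>\<^sup>+z. gauss_density (?m y z) * f (\<alpha> *\<^sub>R ?m y z + \<beta> *\<^sub>R y) * ?c \<partial>lborel) \<partial>lborel)"
    using ab(2) by (intro nn_integral_cong arg_cong2[where f="(*)"] refl nn_integral_lborel_affine) auto
  also have "\<dots> = (\<integral>\<^sup>+y. \<integral>\<^sup>+z. gauss_density y * (gauss_density (?m y z) * f z * ?c) \<partial>lborel \<partial>lborel)"
    unfolding m by (intro nn_integral_cong nn_integral_cmult[symmetric]) measurable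
  also have "\<dots> = (\<integral>\<^sup>+z. \<integral>\<^sup>+y. gauss_density y * (gauss_density (?m y z) * f z * ?c) \<partial>lborel \<partial>lborel)"
    by (rule lborel_pair.Fubini') measurable
  also have "\<dots> = (\<integral>\<^sup>+z. \<integral>\<^sup>+y. gauss_density z * f z * (gauss_density (?m z y) * ?c) \<partial>lborel \<partial>lborel)"
  proof (intro nn_integral_cong)
    fix y z :: 'a
    have "ennreal (gauss_density (?m y z)) * gauss_density y =
          ennreal (gauss_density (?m z y)) * gauss_density z"
      unfolding ennreal_mult[symmetric, OF gauss_density_nonneg gauss_density_nonneg]
        gauss_density_exchange[OF ab] ..
    then have "ennreal (gauss_density (?m y z)) * gauss_density y * (f z * ?c) =
          ennreal (gauss_density (?m z y)) * gauss_density z * (f z * ?c)"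
      by simp
    then show "ennreal (gauss_density y) * (gauss_density (?m y z) * f z * ?c) =
          gauss_density z * f z * (gauss_density (?m z y) * ?c)"
      by (simp only: ac_simps)
  qed
  also have "\<dots> = (\<integral>\<^sup>+z. gauss_density z * f z * (\<integral>\<^sup>+y. gauss_density (?m z y) * ?c \<partial>lborel) \<partial>lborel)"
    by (intro nn_integral_cong nn_integral_cmult) measurable
  also have "\<dots> = (\<integral>\<^sup>+z. f z \<partial>borel_gaussian)"
    unfolding one by (simp add: borel_gaussian_def nn_integral_density)
  finally show ?thesis .
qed

interpretation borel_gaussian_pair:
  pair_prob_space "borel_gaussian :: 'a::euclidean_space measure" "borel_gaussian :: 'b::euclidean_space measure"
  ..

lemma borel_gaussian_rotate:
  assumes ab: "\<alpha>\<^sup>2 + \<beta>\<^sup>2 = 1" "0 < \<alpha>"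
  shows "distr (borel_gaussian \<Otimes>\<^sub>M borel_gaussian) borel (\<lambda>(x, y). \<beta> *\<^sub>R x + \<alpha> *\<^sub>R y)
    = (borel_gaussian :: 'a::euclidean_space measure)"
proof (rule measure_eqI)
  fix S :: "'a set" assume "S \<in> sets (distr (borel_gaussian \<Otimes>\<^sub>M borel_gaussian) borel (\<lambda>(x, y). \<beta> *\<^sub>R x + \<alpha> *\<^sub>R y))"
  then have [measurable]: "S \<in> sets borel" by simp
  let ?D = "distr (borel_gaussian \<Otimes>\<^sub>M borel_gaussian) borel (\<lambda>(x::'a, y). \<beta> *\<^sub>R x + \<alpha> *\<^sub>R y)"
  have "emeasure ?D S = (\<integral>\<^sup>+z. indicator S z \<partial>?D)"
    by simp
  also have "\<dots> = (\<integral>\<^sup>+y. \<integral>\<^sup>+x. indicator S (\<alpha> *\<^sub>R x + \<beta> *\<^sub>R y) \<partial>borel_gaussian \<partial>borel_gaussian)"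
    by (simp add: nn_integral_distr borel_gaussian.nn_integral_fst[symmetric] case_prod_beta' add.commute
      del: nn_integral_indicator)
  also have "\<dots> = emeasure borel_gaussian S"
    by (subst nn_integral_borel_gaussian_rotate[OF _ ab]) auto
  finally show "emeasure ?D S = emeasure borel_gaussian S" .
qed simp

lemma gauss_density_Pair:
  fixes x :: "'a::euclidean_space" and y :: "'b::euclidean_space"
  shows "gauss_density (x, y) = gauss_density x * gauss_density y"
  by (simp add: gauss_density_def norm_Pair powr_add[symmetric] add_divide_distrib mult_exp_exp algebra_simps)

text \<open>An independent pair of Gaussian vectors is a Gaussian vector on the product type, so
  moments, integrability and the heat semigroup need no separate version for pairs.\<close>

lemma borel_gaussian_pair_eq:
  "borel_gaussian \<Otimes>\<^sub>M borel_gaussian = (borel_gaussian :: ('a::euclidean_space \<times> 'b::euclidean_space) measure)"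
proof -
  have "sigma_finite_measure (density lborel (\<lambda>y::'b. ennreal (gauss_density y)))"
    using borel_gaussian.sigma_finite_measure_axioms by (simp add: borel_gaussian_def)
  then have "borel_gaussian \<Otimes>\<^sub>M borel_gaussian = density (lborel \<Otimes>\<^sub>M lborel)
      (\<lambda>(x::'a, y::'b). ennreal (gauss_density x) * ennreal (gauss_density y))"
    unfolding borel_gaussian_def by (intro pair_measure_density) (simp_all add: sigma_finite_lborel)
  then show ?thesis
    unfolding borel_gaussian_def
    by (simp add: lborel_prod gauss_density_Pair[symmetric] ennreal_mult[symmetric] case_prod_beta')
qed

subsection \<open>The heat semigroup\<close>

text \<open>Substituting \<open>sqrt 2 *\<^sub>R x\<close> turns density times integrand back into
  the density, up to the Jacobian. This function dominates every polynomial integrand below.\<close>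

lemma integrable_exp_norm_sq_borel_gaussian:
  "integrable borel_gaussian (\<lambda>y::'a::euclidean_space. exp ((norm y)\<^sup>2 / 4))"
proof (rule integrableI_bounded)
  have *: "gauss_density (0 + sqrt 2 *\<^sub>R x) * exp ((norm (0 + sqrt 2 *\<^sub>R x))\<^sup>2 / 4) = gauss_density x" for x :: 'a
    by (simp add: gauss_density_def power_mult_distrib mult_exp_exp)
  have "(\<integral>\<^sup>+y. norm (exp ((norm (y::'a))\<^sup>2 / 4)) \<partial>borel_gaussian) =
     (\<integral>\<^sup>+y. ennreal (gauss_density y * exp ((norm (y::'a))\<^sup>2 / 4)) \<partial>lborel)"
    by (simp add: borel_gaussian_def nn_integral_density ennreal_mult)
  also have "\<dots> = (\<integral>\<^sup>+x. ennreal (gauss_density (0 + sqrt 2 *\<^sub>R x) * exp ((norm (0 + sqrt 2 *\<^sub>R x))\<^sup>2 / 4))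
      * ennreal (\<bar>sqrt 2\<bar> ^ DIM('a)) \<partial>(lborel :: 'a measure))"
    by (rule nn_integral_lborel_affine) auto
  also have "\<dots> = ennreal (\<bar>sqrt 2\<bar> ^ DIM('a))"
    unfolding * by (simp add: nn_integral_multc nn_integral_gauss_density)
  finally show "(\<integral>\<^sup>+y. norm (exp ((norm (y::'a))\<^sup>2 / 4)) \<partial>borel_gaussian) < \<infinity>" by simp
qed measurable

lemma integrable_borel_gaussian_dominated:
  fixes f :: "'a::euclidean_space \<Rightarrow> 'b::{banach, second_countable_topology}"
  assumes "f \<in> borel_measurable borel" and "\<And>y. norm (f y) \<le> C * exp ((norm y)\<^sup>2 / 4)"
  shows "integrable borel_gaussian f"
proof (rule Bochner_Integration.integrable_bound)
  show "integrable borel_gaussian (\<lambda>y::'a. C * exp ((norm y)\<^sup>2 / 4))"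
    by (intro integrable_mult_right integrable_exp_norm_sq_borel_gaussian)
  show "AE y in borel_gaussian. norm (f y) \<le> norm (C * exp ((norm y)\<^sup>2 / 4))"
  proof (rule AE_I2)
    show "norm (f y) \<le> norm (C * exp ((norm y)\<^sup>2 / 4))" for y
      using assms(2)[of y] unfolding real_norm_def by linarith
  qed
qed (use assms(1) in \<open>simp cong: measurable_cong_sets\<close>)

lemma integrable_borel_gaussian_bounded:
  fixes f :: "'a::euclidean_space \<Rightarrow> real"
  assumes "f \<in> borel_measurable borel" and "\<And>y. \<bar>f y\<bar> \<le> M"
  shows "integrable borel_gaussian f"
  using assms by (intro borel_gaussian.integrable_const_bound[where B = M]) (auto cong: measurable_cong_sets)

lemma one_add_norm_sq_le: "1 + (norm y)\<^sup>2 \<le> 4 * exp ((norm y)\<^sup>2 / 4)"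
proof -
  have "1 + (norm y)\<^sup>2 / 4 \<le> exp ((norm y)\<^sup>2 / 4)"
    by (rule exp_ge_add_one_self)
  then show ?thesis by argo
qed

lemma integrable_borel_gaussian_quadratic:
  fixes f :: "'a::euclidean_space \<Rightarrow> 'b::{banach, second_countable_topology}"
  assumes "f \<in> borel_measurable borel" and le: "\<And>y. norm (f y) \<le> C * (1 + (norm y)\<^sup>2)" and "0 \<le> C"
  shows "integrable borel_gaussian f"
proof (rule integrable_borel_gaussian_dominated[OF assms(1)])
  show "norm (f y) \<le> (C * 4) * exp ((norm y)\<^sup>2 / 4)" for y
    using le[of y] mult_left_mono[OF one_add_norm_sq_le[of y] \<open>0 \<le> C\<close>] by simp
qed

lemma norm_le_one_add_norm_sq: "norm y \<le> 1 + (norm y)\<^sup>2"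
proof -
  have "0 \<le> (norm y - 1 / 2)\<^sup>2" by simp
  then show ?thesis by (simp add: power2_eq_square algebra_simps)
qed

lemma integrable_borel_gaussian_id: "integrable borel_gaussian (\<lambda>y::'a::euclidean_space. y)"
  by (rule integrable_borel_gaussian_quadratic[where C=1]) (auto intro: norm_le_one_add_norm_sq)

lemma integrable_borel_gaussian_inner [simp]: "integrable borel_gaussian (\<lambda>y. a \<bullet> y)"
  by (intro integrable_inner_right integrable_borel_gaussian_id)

lemma integrable_borel_gaussian_inner_mult [simp]: "integrable borel_gaussian (\<lambda>y. (a \<bullet> y) * (b \<bullet> y))"
proof (rule integrable_borel_gaussian_quadratic[where C="norm a * norm b"])
  fix y
  have "\<bar>a \<bullet> y\<bar> * \<bar>b \<bullet> y\<bar> \<le> (norm a * norm y) * (norm b * norm y)"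
    by (intro mult_mono Cauchy_Schwarz_ineq2) auto
  also have "\<dots> \<le> norm a * norm b * (1 + (norm y)\<^sup>2)"
    by (simp add: algebra_simps power2_eq_square)
  finally show "norm ((a \<bullet> y) * (b \<bullet> y)) \<le> norm a * norm b * (1 + (norm y)\<^sup>2)"
    by (simp add: abs_mult)
qed auto

text \<open>The Taylor error of one time step grows like this in the noise. The constant 12 = 3 * 4
  makes the cube of exp(|y|^2/12) equal to exp(|y|^2/4).\<close>

lemma integrable_borel_gaussian_cubed:
  "integrable borel_gaussian (\<lambda>y::'a::euclidean_space. (1 + (norm y)\<^sup>2) ^ 3)"
proof (rule integrable_borel_gaussian_dominated[where C="12 ^ 3"])
  fix y :: 'a
  have "1 + (norm y)\<^sup>2 \<le> 12 * exp ((norm y)\<^sup>2 / 12)"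
  proof -
    have "1 + (norm y)\<^sup>2 / 12 \<le> exp ((norm y)\<^sup>2 / 12)"
      by (rule exp_ge_add_one_self)
    then show ?thesis by argo
  qed
  then have "(1 + (norm y)\<^sup>2) ^ 3 \<le> (12 * exp ((norm y)\<^sup>2 / 12)) ^ 3"
    by (intro power_mono) auto
  also have "\<dots> = 12 ^ 3 * exp ((norm y)\<^sup>2 / 4)"
    by (simp add: power_mult_distrib exp_of_nat_mult[symmetric])
  finally show "norm ((1 + (norm y)\<^sup>2) ^ 3) \<le> 12 ^ 3 * exp ((norm y)\<^sup>2 / 4)"
    by simp
qed auto

text \<open>Reflection symmetry is what makes linear functionals average to zero.\<close>

lemma borel_gaussian_uminus: "distr borel_gaussian borel uminus = (borel_gaussian :: 'a::euclidean_space measure)"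
proof (rule measure_eqI)
  fix S :: "'a set" assume "S \<in> sets (distr borel_gaussian borel uminus)"
  then have [measurable]: "S \<in> sets borel" by simp
  have "emeasure (distr borel_gaussian borel uminus) S = (\<integral>\<^sup>+y. ennreal (indicator S y) \<partial>distr borel_gaussian borel (uminus :: 'a \<Rightarrow> 'a))"
    by (simp add: ennreal_indicator)
  also have "\<dots> = (\<integral>\<^sup>+y. ennreal (gauss_density y * indicator S (- y)) \<partial>lborel)"
    by (subst nn_integral_distr) (auto simp: borel_gaussian_def nn_integral_density ennreal_mult)
  also have "\<dots> = (\<integral>\<^sup>+y. ennreal (gauss_density (0 + (-1) *\<^sub>R y) * indicator S (- (0 + (-1) *\<^sub>R y)))
      * ennreal (\<bar>-1::real\<bar> ^ DIM('a)) \<partial>lborel)"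
    by (rule nn_integral_lborel_affine) auto
  also have "\<dots> = emeasure borel_gaussian S"
    by (simp add: borel_gaussian_def emeasure_density gauss_density_def)
       (auto intro!: nn_integral_cong simp: indicator_def)
  finally show "emeasure (distr borel_gaussian borel uminus) S = emeasure borel_gaussian S" .
qed simp

lemma integral_borel_gaussian_inner [simp]: "(\<integral>y. a \<bullet> y \<partial>borel_gaussian) = 0"
proof -
  have "(\<integral>y. a \<bullet> y \<partial>borel_gaussian) = (\<integral>y. a \<bullet> y \<partial>distr borel_gaussian borel uminus)"
    by (simp add: borel_gaussian_uminus)
  also have "\<dots> = - (\<integral>y. a \<bullet> y \<partial>borel_gaussian)"
    by (subst integral_distr) auto
  finally show ?thesis by simp
qed

lemma measurable_fst_borel [measurable]:
  "(fst :: 'a::euclidean_space \<times> 'b::euclidean_space \<Rightarrow> 'a) \<in> borel_measurable borel"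
  by (intro borel_measurable_continuous_onI continuous_intros)

lemma measurable_snd_borel [measurable]:
  "(snd :: 'a::euclidean_space \<times> 'b::euclidean_space \<Rightarrow> 'b) \<in> borel_measurable borel"
  by (intro borel_measurable_continuous_onI continuous_intros)

lemma integral_borel_gaussian_rotate:
  fixes f :: "'a::euclidean_space \<Rightarrow> real"
  assumes "\<alpha>\<^sup>2 + \<beta>\<^sup>2 = 1" "0 < \<alpha>" and [measurable]: "f \<in> borel_measurable borel"
  shows "(\<integral>w. f (\<beta> *\<^sub>R fst w + \<alpha> *\<^sub>R snd w) \<partial>borel_gaussian) = (\<integral>z. f z \<partial>borel_gaussian)"
proof -
  have "(\<integral>z. f z \<partial>borel_gaussian) =
      (\<integral>z. f z \<partial>distr (borel_gaussian \<Otimes>\<^sub>M borel_gaussian) borel (\<lambda>(x::'a, y). \<beta> *\<^sub>R x + \<alpha> *\<^sub>R y))"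
    by (simp only: borel_gaussian_rotate[OF assms(1,2)])
  also have "\<dots> = (\<integral>w. f (\<beta> *\<^sub>R fst w + \<alpha> *\<^sub>R snd w) \<partial>(borel_gaussian \<Otimes>\<^sub>M borel_gaussian))"
    by (subst integral_distr) (auto simp: case_prod_beta')
  finally show ?thesis
    by (simp only: borel_gaussian_pair_eq)
qed

text \<open>Time is the variance of the added noise, so this is exp(r \<Delta> / 2).\<close>

definition heat :: "real \<Rightarrow> ('a::euclidean_space \<Rightarrow> real) \<Rightarrow> 'a \<Rightarrow> real" where
  "heat r f x = (\<integral>y. f (x + sqrt r *\<^sub>R y) \<partial>borel_gaussian)"

lemma heat_measurable [measurable (raw)]:
  assumes [measurable]: "f \<in> borel_measurable borel"
  shows "heat r f \<in> borel_measurable borel"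
  unfolding heat_def by measurable

lemma heat_0 [simp]: "heat 0 f x = f (x::'a::euclidean_space)"
  using borel_gaussian.prob_space[where 'a='a] by (simp add: heat_def)

lemma integrable_heat:
  fixes f :: "'a::euclidean_space \<Rightarrow> real"
  assumes [measurable]: "f \<in> borel_measurable borel" and "\<And>y. \<bar>f y\<bar> \<le> M"
  shows "integrable borel_gaussian (\<lambda>y. f (x + c *\<^sub>R y))"
  by (rule integrable_borel_gaussian_bounded[where f="\<lambda>y. f (x + c *\<^sub>R y)" and M=M]) (use assms(2) in auto)

lemma heat_le:
  assumes [measurable]: "f \<in> borel_measurable borel" and "\<And>y. m \<le> f y" "\<And>y. f y \<le> M"
  shows "heat r f x \<le> M" "m \<le> heat r f x"
proof -
  have "integrable borel_gaussian (\<lambda>y. f (x + sqrt r *\<^sub>R y))"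
  proof (rule integrable_heat)
    show "\<bar>f y\<bar> \<le> \<bar>m\<bar> + \<bar>M\<bar>" for y using assms(2,3)[of y] by linarith
  qed measurable
  then show "heat r f x \<le> M" "m \<le> heat r f x"
    unfolding heat_def
    by (auto intro!: borel_gaussian.integral_le_const borel_gaussian.integral_ge_const simp: assms)
qed

lemma heat_abs_le:
  assumes [measurable]: "f \<in> borel_measurable borel" and "\<And>y. \<bar>f y\<bar> \<le> M"
  shows "\<bar>heat r f x\<bar> \<le> M"
proof -
  have "- M \<le> f y" "f y \<le> M" for y
    using assms(2)[of y] by linarith+
  then have "heat r f x \<le> M" "- M \<le> heat r f x"
    using heat_le[of f "-M" M r x] by auto
  then show ?thesis by linarith
qed

text \<open>Independent noises of variances r and h add up to one of variance r + h; this is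
  rotation invariance with squared weights r/(r+h) and h/(r+h). The weight \<alpha> must be
  positive, so \<open>h = 0\<close> is treated apart.\<close>

lemma heat_heat:
  assumes [measurable]: "f \<in> borel_measurable borel" and M: "\<And>y. \<bar>f y\<bar> \<le> M"
    and "0 \<le> r" "0 \<le> h"
  shows "heat r (heat h f) x = heat (r + h) f (x::'a::euclidean_space)"
proof (cases "h = 0")
  case False
  define \<alpha> where "\<alpha> = sqrt (h / (r + h))"
  define \<beta> where "\<beta> = sqrt (r / (r + h))"
  have pos: "0 < h" "0 < r + h" using False assms(3,4) by auto
  have "\<alpha>\<^sup>2 + \<beta>\<^sup>2 = h / (r + h) + r / (r + h)"
    using pos assms(3) by (simp add: \<alpha>_def \<beta>_def)
  also have "\<dots> = 1"
    using pos by (simp add: add_divide_distrib[symmetric] add.commute)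
  finally have ab1: "\<alpha>\<^sup>2 + \<beta>\<^sup>2 = 1" .
  have ab2: "0 < \<alpha>" "sqrt (r + h) * \<alpha> = sqrt h" "sqrt (r + h) * \<beta> = sqrt r"
    using pos by (simp_all add: \<alpha>_def \<beta>_def real_sqrt_divide)
  have "heat (r + h) f x = (\<integral>w. f (x + sqrt (r + h) *\<^sub>R (\<beta> *\<^sub>R fst w + \<alpha> *\<^sub>R snd w)) \<partial>borel_gaussian)"
    unfolding heat_def
    by (rule integral_borel_gaussian_rotate[OF ab1 ab2(1), of "\<lambda>z. f (x + sqrt (r + h) *\<^sub>R z)", symmetric]) measurable
  also have "\<dots> = (\<integral>w. f (x + sqrt r *\<^sub>R fst w + sqrt h *\<^sub>R snd w) \<partial>borel_gaussian)"
    by (simp only: scaleR_add_right scaleR_scaleR ab2(2,3) add.assoc)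
  also have "\<dots> = (\<integral>y. \<integral>z. f (x + sqrt r *\<^sub>R y + sqrt h *\<^sub>R z) \<partial>borel_gaussian \<partial>borel_gaussian)"
  proof -
    have "integrable (borel_gaussian \<Otimes>\<^sub>M borel_gaussian) (\<lambda>w. f (x + sqrt r *\<^sub>R fst w + sqrt h *\<^sub>R snd w))"
      unfolding borel_gaussian_pair_eq by (rule integrable_borel_gaussian_bounded[where M=M]) (measurable, rule M)
    from borel_gaussian_pair.integral_fst'[OF this] show ?thesis
      by (simp only: borel_gaussian_pair_eq fst_conv snd_conv)
  qed
  finally show ?thesis by (simp only: heat_def)
next
  case True
  have "heat 0 f = f" by (rule ext) simp
  with True show ?thesis by simp
qed

subsection \<open>Smoothing\<close>

lemma integral_borel_gaussian_density:
  fixes f :: "'a::euclidean_space \<Rightarrow> real"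
  assumes [measurable]: "f \<in> borel_measurable borel"
  shows "(\<integral>y. f y \<partial>borel_gaussian) = (\<integral>y. gauss_density y * f y \<partial>lborel)"
  unfolding borel_gaussian_def by (subst integral_density) auto

lemma gauss_density_shift:
  "gauss_density (y - v) = gauss_density y * exp (v \<bullet> y - (norm v)\<^sup>2 / 2)"
proof -
  have "- (1 / 2) * (norm (y - v))\<^sup>2 = - (1 / 2) * (norm y)\<^sup>2 + (v \<bullet> y - (norm v)\<^sup>2 / 2)"
    unfolding power2_norm_eq_inner by (simp add: inner_diff inner_commute algebra_simps)
  then show ?thesis
    unfolding gauss_density_def times_divide_eq_left mult_exp_exp by simp
qed

text \<open>The Cameron-Martin formula. Translation moves from \<open>f\<close> to a smooth
  exponential weight, so regularity in \<open>v\<close> is obtained for merely measurable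
  \<open>f\<close>.\<close>

lemma integral_borel_gaussian_shift:
  fixes f :: "'a::euclidean_space \<Rightarrow> real"
  assumes [measurable]: "f \<in> borel_measurable borel"
  shows "(\<integral>y. f (v + y) \<partial>borel_gaussian) = (\<integral>y. exp (v \<bullet> y - (norm v)\<^sup>2 / 2) * f y \<partial>borel_gaussian)"
proof -
  have "(\<integral>y. f (v + y) \<partial>borel_gaussian) = (\<integral>y. gauss_density (v + y - v) * f (v + y) \<partial>lborel)"
    by (simp add: integral_borel_gaussian_density)
  also have "\<dots> = (\<integral>y. gauss_density (y - v) * f y \<partial>distr lborel borel ((+) v))"
    by (subst integral_distr) auto
  also have "\<dots> = (\<integral>y. gauss_density y * (exp (v \<bullet> y - (norm v)\<^sup>2 / 2) * f y) \<partial>lborel)"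
    by (simp only: lborel_distr_plus gauss_density_shift mult.assoc)
  also have "\<dots> = (\<integral>y. exp (v \<bullet> y - (norm v)\<^sup>2 / 2) * f y \<partial>borel_gaussian)"
    by (rule integral_borel_gaussian_density[symmetric]) measurable
  finally show ?thesis .
qed

lemma exp_remainder_le: "\<bar>exp s - 1 - s\<bar> \<le> s\<^sup>2 * exp \<bar>s\<bar>" for s :: real
proof -
  obtain t where t: "\<bar>t\<bar> \<le> \<bar>s\<bar>" "exp s = (\<Sum>m<2. s ^ m / fact m) + exp t / fact 2 * s ^ 2"
    using Maclaurin_exp_le[of s 2] by blast
  have eq: "exp s - 1 - s = s\<^sup>2 * (exp t / 2)"
    using t(2) by (simp add: numeral_2_eq_2)
  have "\<bar>exp t / 2\<bar> \<le> exp \<bar>s\<bar>"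
  proof -
    have "exp t \<le> exp \<bar>s\<bar>" using t(1) by simp
    then show ?thesis using exp_gt_zero[of t] by linarith
  qed
  then show ?thesis
    unfolding eq abs_mult by (intro mult_mono) auto
qed

text \<open>The exponent s differs from \<open>v \<bullet> y\<close> by |v|^2/2, and exp s from 1 +
  s by a quadratic error; the factor 2 counts these two. The 12 comes from 3(|y| + 1) \<le> 12 +
  |y|^2/4, that is (|y|/2 - 3)^2 \<ge> 0.\<close>

lemma exp_tilt_remainder_le:
  fixes v y :: "'a::euclidean_space"
  assumes "norm v \<le> 1"
  shows "\<bar>exp (v \<bullet> y - (norm v)\<^sup>2 / 2) - 1 - v \<bullet> y\<bar> \<le> (norm v)\<^sup>2 * (2 * exp 12 * exp ((norm y)\<^sup>2 / 4))"
proof -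
  define z where "z = norm y + 1"
  define s where "s = v \<bullet> y - (norm v)\<^sup>2 / 2"
  have z: "0 \<le> z" "1 \<le> z" by (simp_all add: z_def)
  have vv: "(norm v)\<^sup>2 \<le> norm v"
    using assms by (simp add: power2_eq_square mult_left_le)
  have "\<bar>s\<bar> \<le> norm v * norm y + (norm v)\<^sup>2 / 2"
    using Cauchy_Schwarz_ineq2[of v y] unfolding s_def by (smt (verit) zero_le_power2 divide_nonneg_pos)
  also have "\<dots> \<le> norm v * z"
    using vv norm_ge_zero[of v] unfolding z_def distrib_left by linarith
  finally have s: "\<bar>s\<bar> \<le> norm v * z" .
  then have s2: "s\<^sup>2 \<le> (norm v)\<^sup>2 * z\<^sup>2"
    by (metis abs_le_square_iff abs_mult abs_norm_cancel abs_of_nonneg power_mult_distrib z(1))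
  have sz: "\<bar>s\<bar> \<le> z"
    using s mult_right_mono[OF assms z(1)] by simp
  have ze: "z\<^sup>2 * exp z \<le> exp (3 * z)"
  proof -
    have "z \<le> exp z" using exp_ge_add_one_self[of z] by linarith
    then have "z\<^sup>2 * exp z \<le> (exp z)\<^sup>2 * exp z"
      using z by (intro mult_right_mono power_mono) auto
    also have "\<dots> = exp (3 * z)"
      by (simp add: power2_eq_square mult_exp_exp)
    finally show ?thesis .
  qed
  have e3: "exp (3 * z) \<le> exp 12 * exp ((norm y)\<^sup>2 / 4)"
  proof -
    have "0 \<le> (norm y / 2 - 3)\<^sup>2" by simp
    then have "3 * z \<le> 12 + (norm y)\<^sup>2 / 4"
      by (simp add: z_def power2_eq_square algebra_simps)
    then show ?thesis by (simp add: mult_exp_exp)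
  qed
  have "\<bar>exp s - 1 - v \<bullet> y\<bar> \<le> \<bar>exp s - 1 - s\<bar> + (norm v)\<^sup>2"
    unfolding s_def by (smt (verit) zero_le_power2 field_sum_of_halves)
  also have "\<dots> \<le> (norm v)\<^sup>2 * z\<^sup>2 * exp z + (norm v)\<^sup>2 * exp (3 * z)"
  proof (intro add_mono)
    have "s\<^sup>2 * exp \<bar>s\<bar> \<le> (norm v)\<^sup>2 * z\<^sup>2 * exp z"
      using s2 sz by (intro mult_mono) auto
    then show "\<bar>exp s - 1 - s\<bar> \<le> (norm v)\<^sup>2 * z\<^sup>2 * exp z"
      using exp_remainder_le[of s] by linarith
    show "(norm v)\<^sup>2 \<le> (norm v)\<^sup>2 * exp (3 * z)"
      using z by (simp add: mult_le_cancel_left1)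
  qed
  also have "\<dots> \<le> (norm v)\<^sup>2 * (2 * exp (3 * z))"
    using mult_left_mono[OF ze zero_le_power2[of "norm v"]] by (simp add: algebra_simps)
  also have "\<dots> \<le> (norm v)\<^sup>2 * (2 * exp 12 * exp ((norm y)\<^sup>2 / 4))"
    using e3 by (intro mult_left_mono) auto
  finally show ?thesis by (simp add: s_def)
qed

text \<open>A first-order expansion with bounded gradient and quadratic error, uniform in the base
  point. It stands in for bounds on the first two derivatives.\<close>

definition linear_approx :: "real \<Rightarrow> ('a::euclidean_space \<Rightarrow> real) \<Rightarrow> bool" where
  "linear_approx K f \<longleftrightarrow> (\<forall>x. \<exists>a. norm a \<le> K \<and> (\<forall>w. \<bar>f (x + w) - f x - a \<bullet> w\<bar> \<le> K * (norm w)\<^sup>2))"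

text \<open>The order of quantifiers matters: \<open>K\<close> depends on \<tau> and M only, so one
  \<open>K\<close> serves every function met along a flow that preserves the bound M.\<close>

lemma heat_linear_approx:
  fixes \<tau> M :: real
  assumes "0 < \<tau>" and "0 \<le> M"
  obtains K where "0 \<le> K" and
    "\<And>g :: 'a::euclidean_space \<Rightarrow> real. g \<in> borel_measurable borel \<Longrightarrow> (\<And>y. \<bar>g y\<bar> \<le> M) \<Longrightarrow> linear_approx K (heat \<tau> g)"
proof
  define B :: "'a \<Rightarrow> real" where "B y = 2 * exp 12 * exp ((norm y)\<^sup>2 / 4)" for y
  define K0 where "K0 = (\<integral>y. B y \<partial>borel_gaussian)"
  define K1 where "K1 = (\<integral>y. norm (y::'a) \<partial>borel_gaussian)"
  \<comment> \<open>The first summand bounds the gradient, the second the quadratic error; the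
    powers of \<tau> come from the rescaling \<open>w = sqrt \<tau> *\<^sub>R v\<close>.\<close>
  define K where "K = M * K1 / sqrt \<tau> + (M * K0 + 2 * M + M * K1) / \<tau>"
  have intB: "integrable borel_gaussian B"
    unfolding B_def by (intro integrable_mult_right integrable_exp_norm_sq_borel_gaussian)
  have intn: "integrable borel_gaussian (\<lambda>y::'a. norm y)"
    by (intro integrable_norm integrable_borel_gaussian_id)
  have K01: "0 \<le> K0" "0 \<le> K1"
    unfolding K0_def K1_def B_def by (intro integral_nonneg_AE; simp)+
  have MK: "0 \<le> M * K0" "0 \<le> M * K1" using K01 assms(2) by auto
  show "0 \<le> K" unfolding K_def using MK assms by (intro add_nonneg_nonneg divide_nonneg_nonneg) auto
  fix g :: "'a \<Rightarrow> real" assume g[measurable]: "g \<in> borel_measurable borel" and gM: "\<And>y. \<bar>g y\<bar> \<le> M"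
  show "linear_approx K (heat \<tau> g)"
    unfolding linear_approx_def
  proof
    fix x :: 'a
    define G where "G y = g (x + sqrt \<tau> *\<^sub>R y)" for y
    have [measurable]: "G \<in> borel_measurable borel" unfolding G_def by measurable
    have GM: "\<bar>G y\<bar> \<le> M" for y by (simp add: G_def gM)
    have Gle: "\<bar>G y * c\<bar> \<le> M * \<bar>c\<bar>" for y c
      by (simp add: abs_mult GM mult_right_mono)
    have intG: "integrable borel_gaussian G"
      by (rule integrable_borel_gaussian_bounded[where M=M]) (auto intro: GM)
    have intGy: "integrable borel_gaussian (\<lambda>y. G y *\<^sub>R y)"
      by (rule integrable_borel_gaussian_quadratic[where C=M])
         (use GM norm_le_one_add_norm_sq assms(2) in \<open>auto intro!: mult_mono\<close>)
    \<comment> \<open>The gradient of \<open>heat \<tau> g\<close> at x, up to the factor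
      \<open>1 / sqrt \<tau>\<close>: the exponential weight has derivative y in v at v = 0.\<close>
    define c where "c = (\<integral>y. G y *\<^sub>R y \<partial>borel_gaussian)"
    have cv: "c \<bullet> v = (\<integral>y. G y * (v \<bullet> y) \<partial>borel_gaussian)" for v
    proof -
      have "v \<bullet> c = (\<integral>y. v \<bullet> (G y *\<^sub>R y) \<partial>borel_gaussian)"
        unfolding c_def by (subst integral_inner_right) (use intGy in auto)
      then show ?thesis by (simp add: inner_commute)
    qed
    have cn: "norm c \<le> M * K1"
    proof -
      have "norm c \<le> (\<integral>y. norm (G y *\<^sub>R y) \<partial>borel_gaussian)"
        unfolding c_def by (rule integral_norm_bound)
      also have "\<dots> \<le> (\<integral>y. M * norm (y::'a) \<partial>borel_gaussian)"
        by (rule Bochner_Integration.integral_mono) (use integrable_norm[OF intGy] intn GM in \<open>auto intro: mult_right_mono\<close>)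
      finally show ?thesis using intn by (simp add: K1_def)
    qed
    have h: "heat \<tau> g (x + sqrt \<tau> *\<^sub>R v) = (\<integral>y. exp (v \<bullet> y - (norm v)\<^sup>2 / 2) * G y \<partial>borel_gaussian)" for v
      unfolding heat_def integral_borel_gaussian_shift[symmetric, OF \<open>G \<in> borel_measurable borel\<close>]
      by (simp add: G_def scaleR_add_right add.assoc)
    have h0: "heat \<tau> g x = (\<integral>y. G y \<partial>borel_gaussian)"
      by (simp add: heat_def G_def)
    have main: "\<bar>heat \<tau> g (x + sqrt \<tau> *\<^sub>R v) - heat \<tau> g x - c \<bullet> v\<bar> \<le> (M * K0 + 2 * M + M * K1) * (norm v)\<^sup>2" for v
    proof (cases "norm v \<le> 1")
      case True
      have i1: "integrable borel_gaussian (\<lambda>y. G y * (exp (v \<bullet> y - (norm v)\<^sup>2 / 2) - 1 - v \<bullet> y))"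
      proof (rule Bochner_Integration.integrable_bound)
        show "integrable borel_gaussian (\<lambda>y. M * ((norm v)\<^sup>2 * B y))"
          using intB by simp
        show "AE y in borel_gaussian. norm (G y * (exp (v \<bullet> y - (norm v)\<^sup>2 / 2) - 1 - v \<bullet> y)) \<le> norm (M * ((norm v)\<^sup>2 * B y))"
        proof (rule AE_I2)
          fix y
          have "M * \<bar>exp (v \<bullet> y - (norm v)\<^sup>2 / 2) - 1 - v \<bullet> y\<bar> \<le> M * ((norm v)\<^sup>2 * B y)"
            unfolding B_def by (intro mult_left_mono exp_tilt_remainder_le True assms)
          then show "norm (G y * (exp (v \<bullet> y - (norm v)\<^sup>2 / 2) - 1 - v \<bullet> y)) \<le> norm (M * ((norm v)\<^sup>2 * B y))"
            unfolding real_norm_def using Gle[of y "exp (v \<bullet> y - (norm v)\<^sup>2 / 2) - 1 - v \<bullet> y"] by linarith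
        qed
      qed measurable
      have i2: "integrable borel_gaussian (\<lambda>y. G y * (v \<bullet> y))"
        using integrable_inner_right[OF intGy, of v] by simp
      have i3: "integrable borel_gaussian (\<lambda>y. exp (v \<bullet> y - (norm v)\<^sup>2 / 2) * G y)"
        using Bochner_Integration.integrable_add[OF Bochner_Integration.integrable_add[OF i1 intG] i2]
        by (simp add: algebra_simps)
      have "heat \<tau> g (x + sqrt \<tau> *\<^sub>R v) - heat \<tau> g x - c \<bullet> v =
          (\<integral>y. G y * (exp (v \<bullet> y - (norm v)\<^sup>2 / 2) - 1 - v \<bullet> y) \<partial>borel_gaussian)"
        unfolding h h0 cv
        by (subst Bochner_Integration.integral_diff[symmetric] , (intro i3 intG i2 Bochner_Integration.integrable_diff)+)+
           (simp add: algebra_simps)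
      also have "\<bar>\<dots>\<bar> \<le> (\<integral>y. M * ((norm v)\<^sup>2 * B y) \<partial>borel_gaussian)"
      proof (rule order_trans[OF integral_abs_bound], rule Bochner_Integration.integral_mono)
        fix y
        have "M * \<bar>exp (v \<bullet> y - (norm v)\<^sup>2 / 2) - 1 - v \<bullet> y\<bar> \<le> M * ((norm v)\<^sup>2 * B y)"
          unfolding B_def by (intro mult_left_mono exp_tilt_remainder_le True assms)
        then show "\<bar>G y * (exp (v \<bullet> y - (norm v)\<^sup>2 / 2) - 1 - v \<bullet> y)\<bar> \<le> M * ((norm v)\<^sup>2 * B y)"
          using Gle[of y "exp (v \<bullet> y - (norm v)\<^sup>2 / 2) - 1 - v \<bullet> y"] by linarith
      qed (use i1 intB in auto)
      also have "\<dots> = (M * K0) * (norm v)\<^sup>2"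
        by (simp add: K0_def)
      also have "\<dots> \<le> (M * K0 + 2 * M + M * K1) * (norm v)\<^sup>2"
        using MK assms(2) by (intro mult_right_mono) auto
      finally show ?thesis .
    next
      \<comment> \<open>For long v the bound on g and the bound on c suffice, because 1 and |v| are
        at most |v|^2.\<close>
      case False
      then have v: "1 \<le> norm v" by simp
      then have v2: "norm v \<le> (norm v)\<^sup>2" using mult_left_mono[OF v norm_ge_zero[of v]] by (simp add: power2_eq_square)
      have "\<bar>heat \<tau> g (x + sqrt \<tau> *\<^sub>R v) - heat \<tau> g x - c \<bullet> v\<bar> \<le> M + M + (M * K1) * norm v"
        using heat_abs_le[OF g gM, of \<tau> "x + sqrt \<tau> *\<^sub>R v"] heat_abs_le[OF g gM, of \<tau> x]
          Cauchy_Schwarz_ineq2[of c v] mult_right_mono[OF cn norm_ge_zero[of v]] by linarith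
      also have "\<dots> \<le> 2 * M * (norm v)\<^sup>2 + (M * K1) * (norm v)\<^sup>2"
        using MK assms(2) v v2 by (intro add_mono mult_left_mono) (auto simp: mult_le_cancel_left1)
      also have "\<dots> \<le> (M * K0 + 2 * M + M * K1) * (norm v)\<^sup>2"
        using mult_right_mono[OF MK(1) zero_le_power2[of "norm v"]] by (simp add: algebra_simps)
      finally show ?thesis .
    qed
    show "\<exists>a. norm a \<le> K \<and> (\<forall>w. \<bar>heat \<tau> g (x + w) - heat \<tau> g x - a \<bullet> w\<bar> \<le> K * (norm w)\<^sup>2)"
    proof (intro exI[of _ "(1 / sqrt \<tau>) *\<^sub>R c"] conjI allI)
      have "norm c / sqrt \<tau> \<le> M * K1 / sqrt \<tau>"
        using cn assms(1) by (intro divide_right_mono) auto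
      also have "\<dots> \<le> K"
        unfolding K_def using MK assms by simp
      finally show "norm ((1 / sqrt \<tau>) *\<^sub>R c) \<le> K" using assms(1) by simp
      fix w :: 'a
      define v where "v = (1 / sqrt \<tau>) *\<^sub>R w"
      have w: "w = sqrt \<tau> *\<^sub>R v" "((1 / sqrt \<tau>) *\<^sub>R c) \<bullet> w = c \<bullet> v" "(norm v)\<^sup>2 = (norm w)\<^sup>2 / \<tau>"
        using assms(1) by (auto simp: v_def power_mult_distrib power_divide)
      have "\<bar>heat \<tau> g (x + w) - heat \<tau> g x - ((1 / sqrt \<tau>) *\<^sub>R c) \<bullet> w\<bar> \<le> (M * K0 + 2 * M + M * K1) * (norm v)\<^sup>2"
        using main[of v] unfolding w(2) w(1)[symmetric] .
      also have "\<dots> = ((M * K0 + 2 * M + M * K1) / \<tau>) * (norm w)\<^sup>2"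
        by (simp add: w(3))
      also have "\<dots> \<le> K * (norm w)\<^sup>2"
        unfolding K_def using MK assms by (intro mult_right_mono) auto
      finally show "\<bar>heat \<tau> g (x + w) - heat \<tau> g x - ((1 / sqrt \<tau>) *\<^sub>R c) \<bullet> w\<bar> \<le> K * (norm w)\<^sup>2" .
    qed
  qed
qed

subsection \<open>Taylor estimates\<close>

text \<open>The expansion goes to fourth order because the fourth derivative is nonpositive on all
  of t > 0. Dropping that remainder gives an upper bound for every positive t, not only near
  1.\<close>

lemma powr_le_taylor:
  fixes \<alpha> t :: real
  assumes "0 \<le> \<alpha>" "\<alpha> \<le> 1" "0 < t"
  shows "t powr \<alpha> \<le> 1 + \<alpha> * (t - 1) - \<alpha> * (1 - \<alpha>) / 2 * (t - 1)\<^sup>2 + \<bar>t - 1\<bar> ^ 3"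
proof (cases "t = 1")
  case False
  define diff where "diff m x = (\<Prod>i<m. \<alpha> - real i) * x powr (\<alpha> - real m)" for m :: nat and x
  have "\<exists>\<xi>. (if t < 1 then t < \<xi> \<and> \<xi> < 1 else 1 < \<xi> \<and> \<xi> < t) \<and>
      t powr \<alpha> = (\<Sum>m<4. diff m 1 / fact m * (t - 1) ^ m) + diff 4 \<xi> / fact 4 * (t - 1) ^ 4"
  proof (rule Taylor[where a="min t 1" and b="max t 1"])
    show "\<forall>m x. m < 4 \<and> min t 1 \<le> x \<and> x \<le> max t 1 \<longrightarrow> (diff m has_real_derivative diff (Suc m) x) (at x)"
    proof (intro allI impI)
      fix m :: nat and x assume "m < 4 \<and> min t 1 \<le> x \<and> x \<le> max t 1"
      then have "0 < x" using assms(3) by (auto simp: min_def split: if_splits)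
      then show "(diff m has_real_derivative diff (Suc m) x) (at x)"
        unfolding diff_def by (auto intro!: derivative_eq_intros simp: algebra_simps)
    qed
  qed (use False in \<open>auto simp: diff_def fun_eq_iff\<close>)
  then obtain \<xi> where \<xi>: "0 < \<xi>"
    and eq: "t powr \<alpha> = (\<Sum>m<4. diff m 1 / fact m * (t - 1) ^ m) + diff 4 \<xi> / fact 4 * (t - 1) ^ 4"
    using assms(3) by (smt (verit))
  have p: "(\<Prod>i<4. \<alpha> - real i) = - (\<alpha> * (1 - \<alpha>) * (2 - \<alpha>) * (3 - \<alpha>))"
    by (simp add: numeral_eq_Suc algebra_simps)
  have "0 \<le> \<alpha> * (1 - \<alpha>) * (2 - \<alpha>) * (3 - \<alpha>)"
    using assms by (intro mult_nonneg_nonneg) auto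
  then have "diff 4 \<xi> \<le> 0"
    unfolding diff_def p by (simp add: mult_nonneg_nonneg)
  then have "diff 4 \<xi> / fact 4 * (t - 1) ^ 4 \<le> 0"
    by (intro mult_nonpos_nonneg divide_nonpos_pos) auto
  then have 1: "t powr \<alpha> \<le> (\<Sum>m<4. diff m 1 / fact m * (t - 1) ^ m)"
    using eq by linarith
  have 2: "(\<Sum>m<4. diff m 1 / fact m * (t - 1) ^ m) =
      1 + \<alpha> * (t - 1) - \<alpha> * (1 - \<alpha>) / 2 * (t - 1)\<^sup>2 + \<alpha> * (1 - \<alpha>) * (2 - \<alpha>) / 6 * (t - 1) ^ 3"
    by (simp add: diff_def numeral_eq_Suc field_simps)
  have c: "0 \<le> \<alpha> * (1 - \<alpha>) * (2 - \<alpha>) / 6" "\<alpha> * (1 - \<alpha>) * (2 - \<alpha>) / 6 \<le> 1"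
  proof -
    show "0 \<le> \<alpha> * (1 - \<alpha>) * (2 - \<alpha>) / 6" using assms by simp
    have "\<alpha> * (1 - \<alpha>) * (2 - \<alpha>) \<le> 1 * 1 * 2"
      using assms by (intro mult_mono mult_nonneg_nonneg) auto
    then show "\<alpha> * (1 - \<alpha>) * (2 - \<alpha>) / 6 \<le> 1" by simp
  qed
  have "\<alpha> * (1 - \<alpha>) * (2 - \<alpha>) / 6 * (t - 1) ^ 3 \<le> \<alpha> * (1 - \<alpha>) * (2 - \<alpha>) / 6 * \<bar>t - 1\<bar> ^ 3"
    by (rule mult_left_mono[OF _ c(1)]) (simp add: power_abs[symmetric] abs_ge_self)
  also have "\<dots> \<le> 1 * \<bar>t - 1\<bar> ^ 3"
    by (rule mult_right_mono[OF c(2)]) simp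
  finally show ?thesis using 1 2 by simp
qed simp

text \<open>Multiplying the two one-variable bounds leaves exactly ten terms of total degree 3 to 6.
  Each is at most R^3 s^3, since the surplus powers of s are absorbed by R \<ge> 1.\<close>

lemma powr_mult_le_taylor:
  fixes \<alpha> \<beta> x y s R :: real
  assumes ab: "0 \<le> \<alpha>" "\<alpha> \<le> 1" "0 \<le> \<beta>" "\<beta> \<le> 1"
    and pos: "0 < 1 + x" "0 < 1 + y"
    and s: "\<bar>x\<bar> \<le> s" "\<bar>y\<bar> \<le> s" "s \<le> R" "1 \<le> R"
  shows "(1 + x) powr \<alpha> * (1 + y) powr \<beta> \<le> 1 + \<alpha> * x + \<beta> * y - \<alpha> * (1 - \<alpha>) / 2 * x\<^sup>2
     - \<beta> * (1 - \<beta>) / 2 * y\<^sup>2 + \<alpha> * \<beta> * (x * y) + 10 * R ^ 3 * s ^ 3"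
proof -
  define a where "a = \<alpha> * (1 - \<alpha>) / 2"
  define b where "b = \<beta> * (1 - \<beta>) / 2"
  have a: "0 \<le> a" "a \<le> 1"
    using ab mult_mono[of \<alpha> 1 "1 - \<alpha>" 1] by (auto simp: a_def)
  have b: "0 \<le> b" "b \<le> 1"
    using ab mult_mono[of \<beta> 1 "1 - \<beta>" 1] by (auto simp: b_def)
  have s0: "0 \<le> s" using s(1) abs_ge_zero[of x] by linarith
  have "(1 + x) powr \<alpha> * (1 + y) powr \<beta> \<le>
      (1 + \<alpha> * x - a * x\<^sup>2 + \<bar>x\<bar> ^ 3) * (1 + \<beta> * y - b * y\<^sup>2 + \<bar>y\<bar> ^ 3)"
  proof (rule mult_mono)
    show le: "(1 + x) powr \<alpha> \<le> 1 + \<alpha> * x - a * x\<^sup>2 + \<bar>x\<bar> ^ 3"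
      using powr_le_taylor[OF ab(1,2) pos(1)] by (simp add: a_def)
    show "(1 + y) powr \<beta> \<le> 1 + \<beta> * y - b * y\<^sup>2 + \<bar>y\<bar> ^ 3"
      using powr_le_taylor[OF ab(3,4) pos(2)] by (simp add: b_def)
    show "0 \<le> 1 + \<alpha> * x - a * x\<^sup>2 + \<bar>x\<bar> ^ 3"
      by (rule order_trans[OF powr_ge_zero le])
  qed simp
  also have "\<dots> = (1 + \<alpha> * x + \<beta> * y - a * x\<^sup>2 - b * y\<^sup>2 + \<alpha> * \<beta> * (x * y)) +
     (\<bar>x\<bar> ^ 3 + \<bar>y\<bar> ^ 3 - \<alpha> * b * (x * y\<^sup>2) - \<beta> * a * (y * x\<^sup>2) + a * b * (x\<^sup>2 * y\<^sup>2)
      + \<alpha> * (x * \<bar>y\<bar> ^ 3) + \<beta> * (y * \<bar>x\<bar> ^ 3) - a * (x\<^sup>2 * \<bar>y\<bar> ^ 3) - b * (y\<^sup>2 * \<bar>x\<bar> ^ 3) + \<bar>x\<bar> ^ 3 * \<bar>y\<bar> ^ 3)"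
    by (simp add: algebra_simps)
  also have "\<dots> \<le> (1 + \<alpha> * x + \<beta> * y - a * x\<^sup>2 - b * y\<^sup>2 + \<alpha> * \<beta> * (x * y)) + 10 * R ^ 3 * s ^ 3"
  proof (rule add_left_mono)
    define T where "T = R ^ 3 * s ^ 3"
    have mono: "c * (u * v) \<le> T \<and> - (c * (u * v)) \<le> T"
      if "0 \<le> c" "c \<le> 1" "\<bar>u\<bar> \<le> s ^ i" "\<bar>v\<bar> \<le> s ^ j" "3 \<le> i + j" "i + j \<le> 6" for c u v i j
    proof -
      have "\<bar>c * (u * v)\<bar> \<le> 1 * (s ^ i * s ^ j)"
        unfolding abs_mult using that s0 by (intro mult_mono) auto
      also have "\<dots> = s ^ (i + j - 3) * s ^ 3"
        using that(5) by (simp add: power_add[symmetric])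
      also have "\<dots> \<le> R ^ (i + j - 3) * s ^ 3"
        using s s0 by (intro mult_right_mono power_mono) auto
      also have "\<dots> \<le> R ^ 3 * s ^ 3"
        using s s0 that(6) by (intro mult_right_mono power_increasing) auto
      finally show ?thesis unfolding T_def by linarith
    qed
    have sq: "\<bar>x\<^sup>2\<bar> \<le> s ^ 2" "\<bar>y\<^sup>2\<bar> \<le> s ^ 2" "\<bar>\<bar>x\<bar> ^ 3\<bar> \<le> s ^ 3" "\<bar>\<bar>y\<bar> ^ 3\<bar> \<le> s ^ 3"
        "\<bar>x\<bar> \<le> s ^ 1" "\<bar>y\<bar> \<le> s ^ 1" "\<bar>1::real\<bar> \<le> s ^ 0"
      using s power_mono[OF s(1), of 2] power_mono[OF s(2), of 2] power_mono[OF s(1), of 3] power_mono[OF s(2), of 3]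
      by auto
    have c: "0 \<le> \<alpha> * b" "\<alpha> * b \<le> 1" "0 \<le> \<beta> * a" "\<beta> * a \<le> 1" "0 \<le> a * b" "a * b \<le> 1"
      using ab a b by (auto intro: mult_le_one)
    note t = mono[OF _ _ sq(3) sq(7), of 1] mono[OF _ _ sq(4) sq(7), of 1]
      mono[OF c(1,2) sq(5) sq(2)] mono[OF c(3,4) sq(6) sq(1)] mono[OF c(5,6) sq(1) sq(2)]
      mono[OF ab(1,2) sq(5) sq(4)] mono[OF ab(3,4) sq(6) sq(3)] mono[OF a sq(1) sq(4)]
      mono[OF b sq(2) sq(3)] mono[OF _ _ sq(3) sq(4), of 1]
    have "\<bar>x\<bar> ^ 3 \<le> T" "\<bar>y\<bar> ^ 3 \<le> T" "\<bar>x\<bar> ^ 3 * \<bar>y\<bar> ^ 3 \<le> T"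
      "- (\<alpha> * b * (x * y\<^sup>2)) \<le> T" "- (\<beta> * a * (y * x\<^sup>2)) \<le> T" "a * b * (x\<^sup>2 * y\<^sup>2) \<le> T"
      "\<alpha> * (x * \<bar>y\<bar> ^ 3) \<le> T" "\<beta> * (y * \<bar>x\<bar> ^ 3) \<le> T"
      "- (a * (x\<^sup>2 * \<bar>y\<bar> ^ 3)) \<le> T" "- (b * (y\<^sup>2 * \<bar>x\<bar> ^ 3)) \<le> T"
      using t by simp_all
    moreover have "10 * R ^ 3 * s ^ 3 = 10 * T" by (simp add: T_def)
    ultimately show "\<bar>x\<bar> ^ 3 + \<bar>y\<bar> ^ 3 - \<alpha> * b * (x * y\<^sup>2) - \<beta> * a * (y * x\<^sup>2) + a * b * (x\<^sup>2 * y\<^sup>2)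
      + \<alpha> * (x * \<bar>y\<bar> ^ 3) + \<beta> * (y * \<bar>x\<bar> ^ 3) - a * (x\<^sup>2 * \<bar>y\<bar> ^ 3) - b * (y\<^sup>2 * \<bar>x\<bar> ^ 3) + \<bar>x\<bar> ^ 3 * \<bar>y\<bar> ^ 3
      \<le> 10 * R ^ 3 * s ^ 3"
      by linarith
  qed
  finally show ?thesis by (simp add: a_def b_def)
qed

text \<open>In the application \<open>\<delta>\<close> is the square root of the time step, \<open>X\<close> and \<open>Y\<close> are the linear
  parts of the relative increments and \<open>r\<close>, \<open>r'\<close> their errors.\<close>
lemma powr_mult_le_quadratic:
  fixes \<alpha> \<beta> :: real
  assumes ab: "0 \<le> \<alpha>" "\<alpha> \<le> 1" "0 \<le> \<beta>" "\<beta> \<le> 1"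
    and pos: "0 < 1 + (X + r)" "0 < 1 + (Y + r')" "X + r \<le> R" "Y + r' \<le> R" "1 \<le> R"
    and X: "\<bar>X\<bar> \<le> k * \<delta> * S" "\<bar>r\<bar> \<le> k * \<delta>\<^sup>2 * S"
    and Y: "\<bar>Y\<bar> \<le> k * \<delta> * S" "\<bar>r'\<bar> \<le> k * \<delta>\<^sup>2 * S"
    and k: "1 \<le> k" "0 \<le> \<delta>" "\<delta> \<le> 1" "1 \<le> S"
  shows "(1 + (X + r)) powr \<alpha> * (1 + (Y + r')) powr \<beta> \<le> 1 + \<alpha> * (X + r) + \<beta> * (Y + r')
     + (- \<alpha> * (1 - \<alpha>) / 2 * X\<^sup>2 - \<beta> * (1 - \<beta>) / 2 * Y\<^sup>2 + \<alpha> * \<beta> * (X * Y)) + 85 * R ^ 3 * k ^ 3 * \<delta> ^ 3 * S ^ 3"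
proof -
  define s where "s = max \<bar>X + r\<bar> \<bar>Y + r'\<bar>"
  have kS: "0 \<le> k * \<delta> * S" using k by simp
  have "\<delta>\<^sup>2 \<le> \<delta>" using k by (simp add: power2_eq_square mult_left_le)
  then have "k * \<delta>\<^sup>2 * S \<le> k * \<delta> * S" using k by (intro mult_right_mono mult_left_mono) auto
  then have s2: "s \<le> 2 * (k * \<delta> * S)"
    using X Y unfolding s_def by linarith
  have s0: "0 \<le> s" "\<bar>X + r\<bar> \<le> s" "\<bar>Y + r'\<bar> \<le> s" "s \<le> R"
    using pos unfolding s_def by linarith+
  have "s ^ 3 \<le> (2 * (k * \<delta> * S)) ^ 3" using s0 s2 by (intro power_mono)
  also have "\<dots> = 8 * (k ^ 3 * \<delta> ^ 3 * S ^ 3)" by (simp add: power_mult_distrib)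
  finally have s3: "s ^ 3 \<le> 8 * (k ^ 3 * \<delta> ^ 3 * S ^ 3)" .
  have R3: "1 \<le> R ^ 3" using pos(5) by simp
  define E where "E = k ^ 3 * \<delta> ^ 3 * S ^ 3"
  have E0: "0 \<le> E" using k by (simp add: E_def)
  have kk: "k * k * S * S \<le> k ^ 3 * S ^ 3"
  proof -
    have "k ^ 2 * S ^ 2 \<le> k ^ 3 * S ^ 3"
      using k by (intro mult_mono power_increasing) auto
    then show ?thesis by (simp add: power2_eq_square mult_ac)
  qed
  have prod: "\<bar>u * v\<bar> \<le> E"
    if "\<bar>u\<bar> \<le> k * \<delta> * S" "\<bar>v\<bar> \<le> k * \<delta>\<^sup>2 * S" for u v
  proof -
    have "\<bar>u * v\<bar> \<le> (k * \<delta> * S) * (k * \<delta>\<^sup>2 * S)"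
      unfolding abs_mult using that kS by (intro mult_mono) auto
    also have "\<dots> = \<delta> ^ 3 * (k * k * S * S)" by (simp add: power2_eq_square power3_eq_cube)
    also have "\<dots> \<le> \<delta> ^ 3 * (k ^ 3 * S ^ 3)" using kk k by (intro mult_left_mono) auto
    also have "\<dots> = E" by (simp add: E_def)
    finally show ?thesis .
  qed
  have small: "\<bar>u\<bar> \<le> k * \<delta> * S" if "\<bar>u\<bar> \<le> k * \<delta>\<^sup>2 * S" for u
    using that \<open>k * \<delta>\<^sup>2 * S \<le> k * \<delta> * S\<close> by linarith
  have sq: "- c * (1 - c) / 2 * (u + v)\<^sup>2 \<le> - c * (1 - c) / 2 * u\<^sup>2 + E"
    if "0 \<le> c" "c \<le> 1" "\<bar>u\<bar> \<le> k * \<delta> * S" "\<bar>v\<bar> \<le> k * \<delta>\<^sup>2 * S" for c u v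
  proof -
    have c: "0 \<le> c * (1 - c)" "c * (1 - c) \<le> 1" using that mult_mono[of c 1 "1 - c" 1] by auto
    have "- A * (u + v)\<^sup>2 = - A * u\<^sup>2 - 2 * A * (u * v) - A * v\<^sup>2" for A :: real
      by (simp add: power2_eq_square algebra_simps)
    from this[of "c * (1 - c) / 2"]
    have "- c * (1 - c) / 2 * (u + v)\<^sup>2 = - c * (1 - c) / 2 * u\<^sup>2 - c * (1 - c) * (u * v) - c * (1 - c) / 2 * v\<^sup>2"
      by simp
    moreover have "0 \<le> c * (1 - c) / 2 * v\<^sup>2" using c by simp
    moreover have "\<bar>c * (1 - c) * (u * v)\<bar> \<le> 1 * E"
      unfolding abs_mult[of "c * (1 - c)"] using c prod[OF that(3,4)] by (intro mult_mono) auto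
    ultimately show ?thesis by linarith
  qed
  have cross: "\<alpha> * \<beta> * ((X + r) * (Y + r')) \<le> \<alpha> * \<beta> * (X * Y) + 3 * E"
  proof -
    have c: "0 \<le> \<alpha> * \<beta>" "\<alpha> * \<beta> \<le> 1" using ab by (auto intro: mult_le_one)
    have "X * r' + Y * r + r * r' \<le> 3 * E"
      using prod[OF X(1) Y(2)] prod[OF Y(1) X(2)] prod[OF small[OF X(2)] Y(2)] by linarith
    then have "\<alpha> * \<beta> * (X * r' + Y * r + r * r') \<le> \<alpha> * \<beta> * (3 * E)"
      using c by (intro mult_left_mono)
    also have "\<dots> \<le> 3 * E" using c E0 by (simp add: mult_left_le_one_le)
    finally show ?thesis by (simp add: algebra_simps)
  qed
  \<comment> \<open>The constant is 85 = 10 * 8 + 5: the 8 is the cube of the factor 2 in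
    \<open>s2\<close>, and the 5 counts one E for each square and three for the mixed
    product.\<close>
  have "10 * R ^ 3 * s ^ 3 \<le> 10 * R ^ 3 * (8 * E)"
    using s3 pos(5) by (intro mult_left_mono) (auto simp: E_def)
  moreover have "5 * E \<le> 5 * R ^ 3 * E"
    using R3 E0 by (simp add: mult_le_cancel_right1)
  ultimately have "10 * R ^ 3 * s ^ 3 + 5 * E \<le> 85 * R ^ 3 * E"
    by (simp add: algebra_simps)
  then show ?thesis
    using powr_mult_le_taylor[OF ab pos(1,2) s0(2,3,4) pos(5)] sq[OF ab(1,2) X] sq[OF ab(3,4) Y] cross
    unfolding E_def[symmetric] by (simp add: E_def mult.assoc)
qed

text \<open>The arithmetic-geometric mean inequality for \<open>sqrt A * \<bar>P\<bar>\<close> and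
  \<open>sqrt B * \<bar>Q\<bar>\<close>; the last hypothesis is the discriminant condition.\<close>

lemma binary_quadratic_form_le_0:
  fixes A B c P Q :: real
  assumes "0 \<le> A" "0 \<le> B" "c\<^sup>2 \<le> 4 * A * B"
  shows "- A * P\<^sup>2 - B * Q\<^sup>2 + c * (P * Q) \<le> 0"
proof -
  have "\<bar>c\<bar> \<le> 2 * sqrt A * sqrt B"
    using real_sqrt_le_mono[OF assms(3)] by (simp add: real_sqrt_mult)
  then have "\<bar>c\<bar> * \<bar>P * Q\<bar> \<le> 2 * sqrt A * sqrt B * \<bar>P * Q\<bar>"
    by (intro mult_right_mono) auto
  then have "c * (P * Q) \<le> 2 * (sqrt A * \<bar>P\<bar>) * (sqrt B * \<bar>Q\<bar>)"
    using abs_ge_self[of "c * (P * Q)"] by (simp add: abs_mult mult_ac)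
  also have "\<dots> \<le> (sqrt A * \<bar>P\<bar>)\<^sup>2 + (sqrt B * \<bar>Q\<bar>)\<^sup>2"
    by (rule sum_squares_bound)
  finally show ?thesis using assms by (simp add: power_mult_distrib)
qed

subsection \<open>Two-function hypercontractivity\<close>

lemma distr_borel_gaussian_fst:
  "distr (borel_gaussian :: ('a::euclidean_space \<times> 'b::euclidean_space) measure) borel fst = borel_gaussian"
proof -
  have "distr (borel_gaussian \<Otimes>\<^sub>M borel_gaussian :: ('a \<times> 'b) measure) borel fst
      = distr (borel_gaussian \<Otimes>\<^sub>M borel_gaussian :: ('a \<times> 'b) measure) borel_gaussian fst"
    by (rule distr_cong) auto
  also have "\<dots> = borel_gaussian"
    by (rule borel_gaussian.distr_pair_fst)
  finally show ?thesis by (simp only: borel_gaussian_pair_eq)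
qed

text \<open>The reference value is \<open>heat h f x\<close>, the mean of f over the step, instead
  of \<open>f x\<close>, so that relative increments average to zero. Their linear part is of order
  sqrt h and the rest of order h. The vector z will be a linear image of the noise w, namely either
  component of the correlated pair.\<close>

lemma heat_increment_bounds:
  fixes f :: "'a::euclidean_space \<Rightarrow> real" and w :: "'b::euclidean_space" and a x z :: 'a
  assumes [measurable]: "f \<in> borel_measurable borel"
    and m: "0 < m" "\<And>y. m \<le> f y" "\<And>y. f y \<le> M"
    and a: "norm a \<le> K" "\<And>w. \<bar>f (x + w) - f x - a \<bullet> w\<bar> \<le> K * (norm w)\<^sup>2"
    and h: "0 \<le> h" and z: "norm z \<le> 2 * norm w"
  defines "X \<equiv> sqrt h * (a \<bullet> z) / heat h f x"
    and "I \<equiv> (\<integral>y. 1 + (norm (y :: 'a))\<^sup>2 \<partial>borel_gaussian)"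
    and "k \<equiv> 1 + (6 * K + K * (\<integral>y. 1 + (norm (y :: 'a))\<^sup>2 \<partial>borel_gaussian)) / m"
  shows "\<bar>X\<bar> \<le> k * sqrt h * (1 + (norm w)\<^sup>2)"
    "\<bar>(f (x + sqrt h *\<^sub>R z) - heat h f x) / heat h f x - X\<bar> \<le> k * (sqrt h)\<^sup>2 * (1 + (norm w)\<^sup>2)"
proof -
  define u where "u = heat h f x"
  define S where "S = 1 + (norm w)\<^sup>2"
  have S: "1 \<le> S" "norm w \<le> S" "(norm w)\<^sup>2 \<le> S"
    using norm_le_one_add_norm_sq[of w] by (auto simp: S_def)
  have K: "0 \<le> K" using a(1) norm_ge_zero[of a] by linarith
  have u: "m \<le> u" unfolding u_def by (rule heat_le(2)[OF _ m(2,3)]) measurable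
  have u0: "0 < u" using u m by linarith
  have iq: "integrable borel_gaussian (\<lambda>y::'a. 1 + (norm y)\<^sup>2)"
    by (rule integrable_borel_gaussian_quadratic[where C=1]) auto
  have I0: "0 \<le> I" unfolding I_def by (rule integral_nonneg_AE) auto
  have k: "k = 1 + (6 * K + K * I) / m" by (simp add: k_def I_def)
  have div: "\<bar>q / u\<bar> \<le> c / m" if "\<bar>q\<bar> \<le> c" for q c
  proof -
    have "\<bar>q / u\<bar> = \<bar>q\<bar> / u" using u0 by simp
    also have "\<dots> \<le> c / m" using that u m by (intro frac_le) auto
    finally show ?thesis .
  qed
  have le_k: "(6 * K + K * I) / m * c \<le> k * c" if "0 \<le> c" for c
    using that by (simp add: k algebra_simps)
  have "\<bar>a \<bullet> z\<bar> \<le> norm a * norm z" by (rule Cauchy_Schwarz_ineq2)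
  also have "\<dots> \<le> K * (2 * S)" using a(1) z S K by (intro mult_mono) auto
  also have "\<dots> \<le> (6 * K + K * I) * S"
    using K I0 S by (simp add: algebra_simps)
  finally have "\<bar>sqrt h * (a \<bullet> z)\<bar> \<le> sqrt h * ((6 * K + K * I) * S)"
    using h by (simp add: abs_mult mult_left_mono)
  from div[OF this] have "\<bar>X\<bar> \<le> (6 * K + K * I) / m * (sqrt h * S)"
    by (simp add: X_def u_def mult_ac)
  also have "\<dots> \<le> k * (sqrt h * S)" using h S by (intro le_k) auto
  finally show "\<bar>X\<bar> \<le> k * sqrt h * (1 + (norm w)\<^sup>2)" by (simp add: S_def mult_ac)
  \<comment> \<open>The linear term has mean zero, so replacing \<open>f x\<close> by its average
    costs only order h.\<close>
  have ux: "\<bar>u - f x\<bar> \<le> K * h * I"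
  proof -
    have i1: "integrable borel_gaussian (\<lambda>y. f (x + sqrt h *\<^sub>R y))"
      by (rule integrable_heat[where M="\<bar>m\<bar> + \<bar>M\<bar>"]) (measurable, smt (verit) m(2,3))
    have i2: "integrable borel_gaussian (\<lambda>y::'a. sqrt h * (a \<bullet> y))" by simp
    have "u - f x = (\<integral>y. f (x + sqrt h *\<^sub>R y) - f x - sqrt h * (a \<bullet> y) \<partial>borel_gaussian)"
      using i1 i2 borel_gaussian.prob_space[where 'a='a] by (simp add: u_def heat_def)
    also have "\<bar>\<dots>\<bar> \<le> (\<integral>y. K * h * (1 + (norm (y::'a))\<^sup>2) \<partial>borel_gaussian)"
    proof (rule order_trans[OF integral_abs_bound], rule Bochner_Integration.integral_mono)
      fix y :: 'a
      have "\<bar>f (x + sqrt h *\<^sub>R y) - f x - a \<bullet> (sqrt h *\<^sub>R y)\<bar> \<le> K * (norm (sqrt h *\<^sub>R y))\<^sup>2"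
        by (rule a(2))
      also have "\<dots> \<le> K * h * (1 + (norm y)\<^sup>2)"
        using K h by (simp add: power_mult_distrib algebra_simps)
      finally show "\<bar>f (x + sqrt h *\<^sub>R y) - f x - sqrt h * (a \<bullet> y)\<bar> \<le> K * h * (1 + (norm y)\<^sup>2)" by simp
    qed (use i1 i2 iq in auto)
    also have "\<dots> = K * h * I" using iq by (simp add: I_def)
    finally show ?thesis .
  qed
  have "\<bar>f (x + sqrt h *\<^sub>R z) - f x - a \<bullet> (sqrt h *\<^sub>R z)\<bar> \<le> K * (norm (sqrt h *\<^sub>R z))\<^sup>2"
    by (rule a(2))
  also have "\<dots> = K * h * (norm z)\<^sup>2" using h by (simp add: power_mult_distrib)
  also have "\<dots> \<le> K * h * (4 * S)"
  proof (rule mult_left_mono)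
    have "(norm z)\<^sup>2 \<le> (2 * norm w)\<^sup>2" using z by (intro power_mono) auto
    then show "(norm z)\<^sup>2 \<le> 4 * S" using S by (simp add: power_mult_distrib)
  qed (use K h in simp)
  finally have "\<bar>f (x + sqrt h *\<^sub>R z) - u - sqrt h * (a \<bullet> z)\<bar> \<le> K * h * (4 * S) + K * h * I"
    using ux by (simp add: inner_scaleR_right)
  \<comment> \<open>The last summand brings the total to \<open>6 * K + K * I\<close>, the constant
    from which \<open>k\<close> is built.\<close>
  also have "\<dots> \<le> K * h * (4 * S) + K * h * (I * S) + 2 * (K * h * S)"
    using K h I0 S by (intro order_trans[OF _ add_increasing2[OF _ order_refl]] add_left_mono mult_left_mono) (auto simp: mult_le_cancel_left1)
  also have "\<dots> = h * ((6 * K + K * I) * S)" by (simp add: algebra_simps)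
  finally have "\<bar>f (x + sqrt h *\<^sub>R z) - u - sqrt h * (a \<bullet> z)\<bar> \<le> h * ((6 * K + K * I) * S)" .
  from div[OF this] have "\<bar>(f (x + sqrt h *\<^sub>R z) - u) / u - X\<bar> \<le> (6 * K + K * I) / m * (h * S)"
    by (simp add: X_def u_def diff_divide_distrib mult_ac)
  also have "\<dots> \<le> k * (h * S)" using h S by (intro le_k) auto
  finally show "\<bar>(f (x + sqrt h *\<^sub>R z) - heat h f x) / heat h f x - X\<bar> \<le> k * (sqrt h)\<^sup>2 * (1 + (norm w)\<^sup>2)"
    using h by (simp add: S_def u_def mult_ac)
qed

section \<open>Pairs of standard Gaussian vectors with correlation \<rho>\<close>

context
  fixes \<rho> \<sigma> :: real
  assumes rs: "\<rho>\<^sup>2 + \<sigma>\<^sup>2 = 1" "0 < \<sigma>"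
begin

text \<open>\<open>(couple w, fst w)\<close> is the correlated pair, realised linearly in one
  Gaussian vector of twice the dimension. Functions of the pair therefore evolve under the ordinary
  heat semigroup on the product type.\<close>

definition couple :: "'a::euclidean_space \<times> 'a \<Rightarrow> 'a" where
  "couple w = \<rho> *\<^sub>R fst w + \<sigma> *\<^sub>R snd w"

lemma couple_measurable [measurable]: "couple \<in> borel_measurable borel"
  unfolding couple_def by measurable

lemma couple_add_scaleR: "couple (v + c *\<^sub>R w) = couple v + c *\<^sub>R couple w"
  by (simp add: couple_def algebra_simps)

lemma couple_zero [simp]: "couple 0 = 0"
  by (simp add: couple_def)

lemma inner_couple: "a \<bullet> couple w = (\<rho> *\<^sub>R a, \<sigma> *\<^sub>R a) \<bullet> w"
  by (cases w) (simp add: couple_def inner_add_right)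

lemma norm_couple_le: "norm (couple w) \<le> 2 * norm w"
proof -
  have "\<bar>\<rho>\<bar> \<le> 1" "\<bar>\<sigma>\<bar> \<le> 1"
    unfolding abs_square_le_1[symmetric] using rs(1) zero_le_power2[of \<rho>] zero_le_power2[of \<sigma>] by linarith+
  then have "\<bar>\<rho>\<bar> * norm (fst w) \<le> 1 * norm w" "\<bar>\<sigma>\<bar> * norm (snd w) \<le> 1 * norm w"
    using norm_fst_le[of "fst w" "snd w"] norm_snd_le[of "snd w" "fst w"]
    by (intro mult_mono; simp)+
  then show ?thesis
    using norm_triangle_ineq[of "\<rho> *\<^sub>R fst w" "\<sigma> *\<^sub>R snd w"] by (simp add: couple_def)
qed

lemma distr_couple: "distr borel_gaussian borel couple = borel_gaussian"
  using borel_gaussian_rotate[of \<sigma> \<rho>] rs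
  by (simp add: borel_gaussian_pair_eq couple_def[abs_def] case_prod_beta' add.commute)

lemma integral_couple:
  fixes f :: "'a::euclidean_space \<Rightarrow> real"
  assumes [measurable]: "f \<in> borel_measurable borel"
  shows "(\<integral>w. f (couple w) \<partial>borel_gaussian) = (\<integral>y. f y \<partial>borel_gaussian)"
proof -
  have "(\<integral>y. f y \<partial>distr borel_gaussian borel couple) = (\<integral>w. f (couple w) \<partial>borel_gaussian)"
    by (rule integral_distr) measurable
  then show ?thesis by (simp add: distr_couple)
qed

lemma integral_fst_borel_gaussian:
  fixes f :: "'a::euclidean_space \<Rightarrow> real"
  assumes [measurable]: "f \<in> borel_measurable borel"
  shows "(\<integral>w. f (fst w) \<partial>(borel_gaussian :: ('a \<times> 'b::euclidean_space) measure)) = (\<integral>y. f y \<partial>borel_gaussian)"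
proof -
  have "(\<integral>y. f y \<partial>distr (borel_gaussian :: ('a \<times> 'b) measure) borel fst) = (\<integral>w. f (fst w) \<partial>(borel_gaussian :: ('a \<times> 'b) measure))"
    by (rule integral_distr) measurable
  then show ?thesis by (simp add: distr_borel_gaussian_fst)
qed

text \<open>The component \<open>snd w\<close> is independent of \<open>fst w\<close> and centred,
  so only the \<rho> part of \<open>couple w\<close> contributes.\<close>

lemma integral_inner_couple_mult_inner_fst:
  "(\<integral>w. (a \<bullet> couple w) * (b \<bullet> fst w) \<partial>borel_gaussian) = \<rho> * (\<integral>y. (a \<bullet> y) * (b \<bullet> y) \<partial>borel_gaussian)"
  for a b :: "'a::euclidean_space"
proof -
  have i: "integrable borel_gaussian (\<lambda>w::'a \<times> 'a. (a \<bullet> fst w) * (b \<bullet> fst w))"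
    "integrable borel_gaussian (\<lambda>w::'a \<times> 'a. (a \<bullet> snd w) * (b \<bullet> fst w))"
    using integrable_borel_gaussian_inner_mult[of "(a, 0)" "(b, 0 :: 'a)"]
      integrable_borel_gaussian_inner_mult[of "(0, a)" "(b, 0 :: 'a)"]
    by (simp_all add: inner_Pair case_prod_beta' inner_prod_def)
  have "(\<integral>w. (a \<bullet> snd w) * (b \<bullet> fst w) \<partial>(borel_gaussian :: ('a \<times> 'a) measure)) =
      (\<integral>x. \<integral>y. (a \<bullet> y) * (b \<bullet> x) \<partial>borel_gaussian \<partial>borel_gaussian)"
    using borel_gaussian_pair.integral_fst'[of "\<lambda>w. (a \<bullet> snd w) * (b \<bullet> fst w)"] i(2)
    by (simp add: borel_gaussian_pair_eq)
  then have 0: "(\<integral>w. (a \<bullet> snd w) * (b \<bullet> fst w) \<partial>(borel_gaussian :: ('a \<times> 'a) measure)) = 0"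
    by simp
  have "(\<integral>w. (a \<bullet> couple w) * (b \<bullet> fst w) \<partial>borel_gaussian) =
      (\<integral>w. \<rho> * ((a \<bullet> fst w) * (b \<bullet> fst w)) + \<sigma> * ((a \<bullet> snd w) * (b \<bullet> fst w)) \<partial>borel_gaussian)"
    by (simp add: couple_def inner_add_right algebra_simps)
  also have "\<dots> = \<rho> * (\<integral>w. (a \<bullet> fst w) * (b \<bullet> fst w) \<partial>(borel_gaussian :: ('a \<times> 'a) measure))"
    using i 0 by simp
  finally show ?thesis
    using integral_fst_borel_gaussian[of "\<lambda>y. (a \<bullet> y) * (b \<bullet> y)", where 'b='a] by simp
qed

lemma integrable_couple_quadratic:
  fixes a b :: "'a::euclidean_space"
  shows "integrable borel_gaussian (\<lambda>w. (a \<bullet> couple w)\<^sup>2)"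
    "integrable borel_gaussian (\<lambda>w::'a \<times> 'a. (b \<bullet> fst w)\<^sup>2)"
    "integrable borel_gaussian (\<lambda>w. (a \<bullet> couple w) * (b \<bullet> fst w))"
proof -
  have fst: "b \<bullet> fst w = (b, 0) \<bullet> w" for w :: "'a \<times> 'a" by (simp add: inner_prod_def)
  show "integrable borel_gaussian (\<lambda>w. (a \<bullet> couple w)\<^sup>2)"
    "integrable borel_gaussian (\<lambda>w::'a \<times> 'a. (b \<bullet> fst w)\<^sup>2)"
    "integrable borel_gaussian (\<lambda>w. (a \<bullet> couple w) * (b \<bullet> fst w))"
    unfolding power2_eq_square inner_couple fst by (rule integrable_borel_gaussian_inner_mult)+
qed

text \<open>The integrand itself may be positive. Its mean, however, depends on second moments only,
  and these agree with those of a single vector y when c is replaced by \<rho> c; for that form the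
  integrand is nonpositive everywhere. This is where correlation below 1 relaxes the condition on
  the exponents.\<close>

lemma integral_couple_quadratic_le_0:
  fixes a b :: "'a::euclidean_space"
  assumes "0 \<le> A" "0 \<le> B" "(\<rho> * c)\<^sup>2 \<le> 4 * A * B"
  shows "(\<integral>w. - A * (a \<bullet> couple w)\<^sup>2 - B * (b \<bullet> fst w)\<^sup>2 + c * ((a \<bullet> couple w) * (b \<bullet> fst w)) \<partial>borel_gaussian) \<le> 0"
proof -
  note i = integrable_couple_quadratic(1)[of a] integrable_couple_quadratic(2)[of b] integrable_couple_quadratic(3)[of a b]
  have "(\<integral>w. - A * (a \<bullet> couple w)\<^sup>2 - B * (b \<bullet> fst w)\<^sup>2 + c * ((a \<bullet> couple w) * (b \<bullet> fst w)) \<partial>borel_gaussian)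
     = - A * (\<integral>w. (a \<bullet> couple w)\<^sup>2 \<partial>borel_gaussian) - B * (\<integral>w. (b \<bullet> fst w)\<^sup>2 \<partial>(borel_gaussian :: ('a \<times> 'a) measure))
       + c * (\<integral>w. (a \<bullet> couple w) * (b \<bullet> fst w) \<partial>borel_gaussian)"
    using i by simp
  also have "\<dots> = - A * (\<integral>y. (a \<bullet> y)\<^sup>2 \<partial>borel_gaussian) - B * (\<integral>y. (b \<bullet> y)\<^sup>2 \<partial>borel_gaussian)
       + c * (\<rho> * (\<integral>y. (a \<bullet> y) * (b \<bullet> y) \<partial>borel_gaussian))"
    using integral_couple[of "\<lambda>y. (a \<bullet> y)\<^sup>2"] integral_fst_borel_gaussian[of "\<lambda>y. (b \<bullet> y)\<^sup>2", where 'b='a]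
    by (simp add: integral_inner_couple_mult_inner_fst)
  also have "\<dots> = (\<integral>y. - A * (a \<bullet> y)\<^sup>2 - B * (b \<bullet> y)\<^sup>2 + (\<rho> * c) * ((a \<bullet> y) * (b \<bullet> y)) \<partial>borel_gaussian)"
    by (simp add: power2_eq_square algebra_simps)
  also have "\<dots> \<le> 0"
  proof -
    have "0 \<le> (\<integral>y. - (- A * (a \<bullet> y)\<^sup>2 - B * (b \<bullet> y)\<^sup>2 + (\<rho> * c) * ((a \<bullet> y) * (b \<bullet> y))) \<partial>borel_gaussian)"
      using binary_quadratic_form_le_0[OF assms] by (intro integral_nonneg_AE AE_I2) (simp only: neg_0_le_iff_le)
    then show ?thesis
      unfolding Bochner_Integration.integral_minus by (simp only: neg_0_le_iff_le)
  qed
  finally show ?thesis .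
qed

text \<open>Writing A = u (1 + D) and B = v (1 + E), the first-order terms average to zero and the
  second-order ones to something nonpositive, which leaves a cubic error. \<open>C\<close> is fixed
  before the functions, the points and h, so errors of successive steps can be added.\<close>

lemma couple_heat_step:
  fixes m M K :: real
  assumes m: "0 < m" "m \<le> M" and K: "0 \<le> K"
    and ab: "0 \<le> \<alpha>" "\<alpha> \<le> 1" "0 \<le> \<beta>" "\<beta> \<le> 1" "\<rho>\<^sup>2 * \<alpha> * \<beta> \<le> (1 - \<alpha>) * (1 - \<beta>)"
  obtains C where "0 \<le> C" and
    "\<And>(A :: 'a::euclidean_space \<Rightarrow> real) B x y h. A \<in> borel_measurable borel \<Longrightarrow> B \<in> borel_measurable borel \<Longrightarrow>
      (\<And>z. m \<le> A z) \<Longrightarrow> (\<And>z. A z \<le> M) \<Longrightarrow> (\<And>z. m \<le> B z) \<Longrightarrow> (\<And>z. B z \<le> M) \<Longrightarrow>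
      linear_approx K A \<Longrightarrow> linear_approx K B \<Longrightarrow> 0 \<le> h \<Longrightarrow> h \<le> 1 \<Longrightarrow>
      (\<integral>w. A (x + sqrt h *\<^sub>R couple w) powr \<alpha> * B (y + sqrt h *\<^sub>R fst w) powr \<beta> \<partial>borel_gaussian)
      \<le> heat h A x powr \<alpha> * heat h B y powr \<beta> + C * sqrt h ^ 3"
proof
  define k where "k = 1 + (6 * K + K * (\<integral>y. 1 + (norm (y :: 'a))\<^sup>2 \<partial>borel_gaussian)) / m"
  \<comment> \<open>Bounds the relative increments D and E above; since both exceed -1, it bounds
    their absolute values too.\<close>
  define R where "R = M / m"
  define I3 where "I3 = (\<integral>w. (1 + (norm (w :: 'a \<times> 'a))\<^sup>2) ^ 3 \<partial>borel_gaussian)"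
  define C where "C = (M powr \<alpha> * M powr \<beta>) * (85 * R ^ 3 * k ^ 3 * I3)"
  have "0 \<le> (\<integral>y. 1 + (norm (y :: 'a))\<^sup>2 \<partial>borel_gaussian)" by (rule integral_nonneg_AE) auto
  then have k: "1 \<le> k" unfolding k_def using m K by simp
  have R: "1 \<le> R" using m by (simp add: R_def)
  have "0 \<le> I3" unfolding I3_def by (rule integral_nonneg_AE) auto
  then show "0 \<le> C" unfolding C_def using k R by simp
  fix A B :: "'a \<Rightarrow> real" and x y :: 'a and h :: real
  assume [measurable]: "A \<in> borel_measurable borel" "B \<in> borel_measurable borel"
    and A: "\<And>z. m \<le> A z" "\<And>z. A z \<le> M" and B: "\<And>z. m \<le> B z" "\<And>z. B z \<le> M"
    and lA: "linear_approx K A" and lB: "linear_approx K B" and h: "0 \<le> h" "h \<le> 1"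
  obtain a where a: "norm a \<le> K" "\<And>w. \<bar>A (x + w) - A x - a \<bullet> w\<bar> \<le> K * (norm w)\<^sup>2"
    using lA unfolding linear_approx_def by blast
  obtain b where b: "norm b \<le> K" "\<And>w. \<bar>B (y + w) - B y - b \<bullet> w\<bar> \<le> K * (norm w)\<^sup>2"
    using lB unfolding linear_approx_def by blast
  define u where "u = heat h A x"
  define v where "v = heat h B y"
  have u: "m \<le> u" "u \<le> M" unfolding u_def by (rule heat_le[OF _ A]; measurable)+
  have v: "m \<le> v" "v \<le> M" unfolding v_def by (rule heat_le[OF _ B]; measurable)+
  have uv0: "0 < u" "0 < v" using u v m by auto
  define D where "D w = (A (x + sqrt h *\<^sub>R couple w) - u) / u" for w
  define E where "E w = (B (y + sqrt h *\<^sub>R fst w) - v) / v" for w :: "'a \<times> 'a"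
  define X where "X w = sqrt h * (a \<bullet> couple w) / u" for w
  define Y where "Y w = sqrt h * (b \<bullet> fst w) / v" for w :: "'a \<times> 'a"
  define S where "S w = 1 + (norm w)\<^sup>2" for w :: "'a \<times> 'a"
  define q where "q w = - \<alpha> * (1 - \<alpha>) / 2 * (X w)\<^sup>2 - \<beta> * (1 - \<beta>) / 2 * (Y w)\<^sup>2 + \<alpha> * \<beta> * (X w * Y w)" for w
  define P where "P = u powr \<alpha> * v powr \<beta>"
  have P: "0 \<le> P" "P \<le> M powr \<alpha> * M powr \<beta>"
    unfolding P_def using u v uv0 ab by (auto intro!: mult_mono powr_mono2)
  have bound: "\<bar>f z\<bar> \<le> M" if "\<And>z. m \<le> f z" "\<And>z. f z \<le> M" for f :: "'a \<Rightarrow> real" and z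
    using that[of z] m by (auto simp: abs_le_iff)
  have iA: "integrable borel_gaussian (\<lambda>w. A (x + sqrt h *\<^sub>R couple w))"
    by (rule integrable_borel_gaussian_bounded[where M=M]) (measurable, rule bound[OF A])
  have iB: "integrable borel_gaussian (\<lambda>w::'a \<times> 'a. B (y + sqrt h *\<^sub>R fst w))"
    by (rule integrable_borel_gaussian_bounded[where M=M]) (measurable, rule bound[OF B])
  have iD: "integrable borel_gaussian D" "integrable borel_gaussian E"
    unfolding D_def E_def using iA iB by simp_all
  have ID: "(\<integral>w. D w \<partial>borel_gaussian) = 0"
    unfolding D_def using iA integral_couple[of "\<lambda>z. A (x + sqrt h *\<^sub>R z)"] borel_gaussian.prob_space[where 'a="'a \<times> 'a"]
    by (simp add: u_def heat_def)
  have IE: "(\<integral>w. E w \<partial>borel_gaussian) = 0"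
    unfolding E_def using iB integral_fst_borel_gaussian[of "\<lambda>z. B (y + sqrt h *\<^sub>R z)", where 'b='a] borel_gaussian.prob_space[where 'a="'a \<times> 'a"]
    by (simp add: v_def heat_def)
  have qeq: "q w = - (\<alpha> * (1 - \<alpha>) / 2) * ((sqrt h / u) *\<^sub>R a \<bullet> couple w)\<^sup>2
      - (\<beta> * (1 - \<beta>) / 2) * ((sqrt h / v) *\<^sub>R b \<bullet> fst w)\<^sup>2
      + \<alpha> * \<beta> * (((sqrt h / u) *\<^sub>R a \<bullet> couple w) * ((sqrt h / v) *\<^sub>R b \<bullet> fst w))" for w
    by (simp add: q_def X_def Y_def)
  have iq: "integrable borel_gaussian q"
    unfolding qeq[abs_def]
    by (intro Bochner_Integration.integrable_add Bochner_Integration.integrable_diff integrable_mult_right integrable_couple_quadratic)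
  \<comment> \<open>Multiplied by \<alpha>\<beta>, the hypothesis on the exponents becomes the
    discriminant condition for the coefficients \<alpha>(1-\<alpha>)/2, \<beta>(1-\<beta>)/2 and
    \<rho>\<alpha>\<beta>.\<close>
  have Iq: "(\<integral>w. q w \<partial>borel_gaussian) \<le> 0"
    unfolding qeq
  proof (rule integral_couple_quadratic_le_0)
    have "\<rho>\<^sup>2 * \<alpha> * \<beta> * (\<alpha> * \<beta>) \<le> (1 - \<alpha>) * (1 - \<beta>) * (\<alpha> * \<beta>)"
      using ab by (intro mult_right_mono) auto
    moreover have "(\<rho> * (\<alpha> * \<beta>))\<^sup>2 = \<rho>\<^sup>2 * \<alpha> * \<beta> * (\<alpha> * \<beta>)"
      by (simp add: power2_eq_square)
    moreover have "4 * (\<alpha> * (1 - \<alpha>) / 2) * (\<beta> * (1 - \<beta>) / 2) = (1 - \<alpha>) * (1 - \<beta>) * (\<alpha> * \<beta>)"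
      by simp
    ultimately show "(\<rho> * (\<alpha> * \<beta>))\<^sup>2 \<le> 4 * (\<alpha> * (1 - \<alpha>) / 2) * (\<beta> * (1 - \<beta>) / 2)"
      by linarith
  qed (use ab in auto)
  have iS: "integrable borel_gaussian (\<lambda>w. S w ^ 3)"
    unfolding S_def by (rule integrable_borel_gaussian_cubed)
  have point: "A (x + sqrt h *\<^sub>R couple w) powr \<alpha> * B (y + sqrt h *\<^sub>R fst w) powr \<beta>
      \<le> P * (1 + \<alpha> * D w + \<beta> * E w + q w + 85 * R ^ 3 * k ^ 3 * sqrt h ^ 3 * S w ^ 3)" for w
  proof -
    have Aw: "A (x + sqrt h *\<^sub>R couple w) = u * (1 + D w)" and Bw: "B (y + sqrt h *\<^sub>R fst w) = v * (1 + E w)"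
      using uv0 by (simp_all add: D_def E_def field_simps)
    have D0: "0 < 1 + D w" "0 < 1 + E w"
      using A(1)[of "x + sqrt h *\<^sub>R couple w"] B(1)[of "y + sqrt h *\<^sub>R fst w"] m uv0
      unfolding Aw Bw by (smt (verit) zero_less_mult_iff)+
    have le_R: "c / e \<le> R" if "c \<le> M" "m \<le> e" for c e
    proof -
      have "c / e \<le> M / e" using that m by (intro divide_right_mono) auto
      also have "\<dots> \<le> R" unfolding R_def using that m by (intro divide_left_mono) auto
      finally show ?thesis .
    qed
    have DR: "D w \<le> R" "E w \<le> R"
      unfolding D_def E_def
      using A(2)[of "x + sqrt h *\<^sub>R couple w"] B(2)[of "y + sqrt h *\<^sub>R fst w"] u v uv0
      by (intro le_R; linarith)+
    have "norm (fst w) \<le> 2 * norm w"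
      using norm_fst_le[of "fst w" "snd w"] norm_ge_zero[of w] unfolding prod.collapse by linarith
    note incA = heat_increment_bounds[OF \<open>A \<in> _\<close> m(1) A a h(1) norm_couple_le[of w]]
      and incB = heat_increment_bounds[OF \<open>B \<in> _\<close> m(1) B b h(1) this]
    have "(1 + (X w + (D w - X w))) powr \<alpha> * (1 + (Y w + (E w - Y w))) powr \<beta> \<le>
        1 + \<alpha> * (X w + (D w - X w)) + \<beta> * (Y w + (E w - Y w))
        + (- \<alpha> * (1 - \<alpha>) / 2 * (X w)\<^sup>2 - \<beta> * (1 - \<beta>) / 2 * (Y w)\<^sup>2 + \<alpha> * \<beta> * (X w * Y w))
        + 85 * R ^ 3 * k ^ 3 * sqrt h ^ 3 * S w ^ 3"
    proof (rule powr_mult_le_quadratic[OF ab(1-4)])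
      show "\<bar>X w\<bar> \<le> k * sqrt h * S w" "\<bar>D w - X w\<bar> \<le> k * (sqrt h)\<^sup>2 * S w"
        unfolding X_def D_def S_def u_def k_def by (rule incA)+
      show "\<bar>Y w\<bar> \<le> k * sqrt h * S w" "\<bar>E w - Y w\<bar> \<le> k * (sqrt h)\<^sup>2 * S w"
        unfolding Y_def E_def S_def v_def k_def by (rule incB)+
    qed (use D0 DR R k h in \<open>auto simp: S_def\<close>)
    then have "(1 + D w) powr \<alpha> * (1 + E w) powr \<beta> \<le>
        1 + \<alpha> * D w + \<beta> * E w + q w + 85 * R ^ 3 * k ^ 3 * sqrt h ^ 3 * S w ^ 3"
      by (simp add: q_def)
    from mult_left_mono[OF this P(1)] show ?thesis
      unfolding Aw Bw using uv0 D0 by (simp add: P_def powr_mult mult_ac)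
  qed
  have "(\<integral>w. A (x + sqrt h *\<^sub>R couple w) powr \<alpha> * B (y + sqrt h *\<^sub>R fst w) powr \<beta> \<partial>borel_gaussian)
     \<le> (\<integral>w. P * (1 + \<alpha> * D w + \<beta> * E w + q w + 85 * R ^ 3 * k ^ 3 * sqrt h ^ 3 * S w ^ 3) \<partial>borel_gaussian)"
  proof (rule Bochner_Integration.integral_mono)
    show "integrable borel_gaussian (\<lambda>w. A (x + sqrt h *\<^sub>R couple w) powr \<alpha> * B (y + sqrt h *\<^sub>R fst w) powr \<beta>)"
    proof (rule integrable_borel_gaussian_bounded[where M="M powr \<alpha> * M powr \<beta>"])
      fix w
      show "\<bar>A (x + sqrt h *\<^sub>R couple w) powr \<alpha> * B (y + sqrt h *\<^sub>R fst w) powr \<beta>\<bar> \<le> M powr \<alpha> * M powr \<beta>"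
        using A[of "x + sqrt h *\<^sub>R couple w"] B[of "y + sqrt h *\<^sub>R fst w"] m ab
        by (auto simp: abs_mult intro!: mult_mono powr_mono2)
    qed measurable
    show "integrable borel_gaussian (\<lambda>w. P * (1 + \<alpha> * D w + \<beta> * E w + q w + 85 * R ^ 3 * k ^ 3 * sqrt h ^ 3 * S w ^ 3))"
      using iD iq iS by simp
  qed (rule point)
  also have "\<dots> = P * (1 + (\<integral>w. q w \<partial>borel_gaussian) + 85 * R ^ 3 * k ^ 3 * sqrt h ^ 3 * I3)"
    using iD iq iS ID IE borel_gaussian.prob_space[where 'a="'a \<times> 'a"] by (simp add: I3_def S_def[symmetric])
  also have "\<dots> \<le> P * (1 + 85 * R ^ 3 * k ^ 3 * sqrt h ^ 3 * I3)"
    using Iq P(1) by (intro mult_left_mono) auto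
  also have "\<dots> = P + P * (85 * R ^ 3 * k ^ 3 * I3) * sqrt h ^ 3"
    by (simp add: algebra_simps)
  also have "\<dots> \<le> P + C * sqrt h ^ 3"
    unfolding C_def using P(2) R k h \<open>0 \<le> I3\<close> by (intro add_left_mono mult_right_mono) auto
  finally show "(\<integral>w. A (x + sqrt h *\<^sub>R couple w) powr \<alpha> * B (y + sqrt h *\<^sub>R fst w) powr \<beta> \<partial>borel_gaussian)
      \<le> heat h A x powr \<alpha> * heat h B y powr \<beta> + C * sqrt h ^ 3"
    by (simp add: P_def u_def v_def)
qed

text \<open>The error of one step passes through all later averaging without being
  amplified.\<close>

lemma heat_mono_const:
  fixes f g :: "'a::euclidean_space \<Rightarrow> real"
  assumes [measurable]: "f \<in> borel_measurable borel" "g \<in> borel_measurable borel"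
    and f: "\<And>y. \<bar>f y\<bar> \<le> M" and g: "\<And>y. \<bar>g y\<bar> \<le> M" and le: "\<And>y. f y \<le> g y + c"
  shows "heat r f x \<le> heat r g x + c"
proof -
  have i: "integrable borel_gaussian (\<lambda>y. f (x + sqrt r *\<^sub>R y))" "integrable borel_gaussian (\<lambda>y. g (x + sqrt r *\<^sub>R y))"
    by (rule integrable_heat[OF _ f], measurable) (rule integrable_heat[OF _ g], measurable)
  have "heat r f x \<le> (\<integral>y. g (x + sqrt r *\<^sub>R y) + c \<partial>borel_gaussian)"
    unfolding heat_def by (rule Bochner_Integration.integral_mono) (use i le in auto)
  also have "\<dots> = heat r g x + c"
    using i borel_gaussian.prob_space[where 'a='a] by (simp add: heat_def)
  finally show ?thesis .
qed

text \<open>The interpolating quantity is \<open>heat (1 - r) (\<Phi> r) 0\<close>. At r = 0 it is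
  the integral on the left, at r = 1 the product on the right, because \<open>couple\<close> and
  \<open>fst\<close> vanish at 0. The smoothing time \<tau> supplies one expansion constant for the
  whole flow.\<close>

lemma couple_heat_smooth:
  fixes F G :: "'a::euclidean_space \<Rightarrow> real"
  assumes [measurable]: "F \<in> borel_measurable borel" "G \<in> borel_measurable borel"
    and m: "0 < m" and F: "\<And>z. m \<le> F z" "\<And>z. F z \<le> M" and G: "\<And>z. m \<le> G z" "\<And>z. G z \<le> M"
    and ab: "0 \<le> \<alpha>" "\<alpha> \<le> 1" "0 \<le> \<beta>" "\<beta> \<le> 1" "\<rho>\<^sup>2 * \<alpha> * \<beta> \<le> (1 - \<alpha>) * (1 - \<beta>)"
    and \<tau>: "0 < \<tau>"
  shows "(\<integral>w. heat \<tau> F (couple w) powr \<alpha> * heat \<tau> G (fst w) powr \<beta> \<partial>borel_gaussian)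
    \<le> heat (\<tau> + 1) F 0 powr \<alpha> * heat (\<tau> + 1) G 0 powr \<beta>"
proof -
  have mM: "m \<le> M" using F[of 0] by linarith
  then have M0: "0 \<le> M" using m by linarith
  have bF: "\<bar>F z\<bar> \<le> M" and bG: "\<bar>G z\<bar> \<le> M" for z
    using F[of z] G[of z] m by auto
  obtain K where K: "0 \<le> K"
    "\<And>g :: 'a \<Rightarrow> real. g \<in> borel_measurable borel \<Longrightarrow> (\<And>y. \<bar>g y\<bar> \<le> M) \<Longrightarrow> linear_approx K (heat \<tau> g)"
  proof -
    show thesis
      by (rule heat_linear_approx[where 'a='a, OF \<tau> M0]) (fact that)
  qed
  \<comment> \<open>\<open>heat r\<close> preserves the bound M and a further smoothing by
    \<open>heat \<tau>\<close> follows, so \<open>K\<close> does not depend on r.\<close>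
  have la: "linear_approx K (heat (\<tau> + r) g)"
    if [measurable]: "g \<in> borel_measurable borel" and "\<And>y. \<bar>g y\<bar> \<le> M" "0 \<le> r" for g :: "'a \<Rightarrow> real" and r
  proof -
    have "heat (\<tau> + r) g = heat \<tau> (heat r g)"
      using heat_heat[OF that(1,2)] \<tau> that(3) by (intro ext) simp
    moreover have "linear_approx K (heat \<tau> (heat r g))"
      using heat_abs_le[OF that(1,2)] by (intro K(2)) measurable
    ultimately show ?thesis by simp
  qed
  obtain C where C: "0 \<le> C"
    "\<And>(A :: 'a \<Rightarrow> real) B x y h. A \<in> borel_measurable borel \<Longrightarrow> B \<in> borel_measurable borel \<Longrightarrow>
      (\<And>z. m \<le> A z) \<Longrightarrow> (\<And>z. A z \<le> M) \<Longrightarrow> (\<And>z. m \<le> B z) \<Longrightarrow> (\<And>z. B z \<le> M) \<Longrightarrow>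
      linear_approx K A \<Longrightarrow> linear_approx K B \<Longrightarrow> 0 \<le> h \<Longrightarrow> h \<le> 1 \<Longrightarrow>
      (\<integral>w. A (x + sqrt h *\<^sub>R couple w) powr \<alpha> * B (y + sqrt h *\<^sub>R fst w) powr \<beta> \<partial>borel_gaussian)
      \<le> heat h A x powr \<alpha> * heat h B y powr \<beta> + C * sqrt h ^ 3"
  proof -
    show thesis
      by (rule couple_heat_step[where 'a='a, OF m mM K(1) ab]) (fact that)
  qed
  define \<Phi> where "\<Phi> r w = heat (\<tau> + r) F (couple w) powr \<alpha> * heat (\<tau> + r) G (fst w) powr \<beta>" for r w
  have [measurable]: "\<Phi> r \<in> borel_measurable borel" for r unfolding \<Phi>_def by measurable
  note hF = heat_le[OF \<open>F \<in> _\<close> F] and hG = heat_le[OF \<open>G \<in> _\<close> G]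
  define MM where "MM = M powr \<alpha> * M powr \<beta>"
  have \<Phi>b: "\<bar>\<Phi> r w\<bar> \<le> MM" for r w
    using hF[of "\<tau> + r" "couple w"] hG[of "\<tau> + r" "fst w"] m ab
    by (auto simp: \<Phi>_def MM_def abs_mult intro!: mult_mono powr_mono2)
  have step: "heat h (\<Phi> r) w \<le> \<Phi> (r + h) w + C * sqrt h ^ 3" if "0 \<le> r" "0 \<le> h" "h \<le> 1" for r h w
  proof -
    have "heat h (\<Phi> r) w = (\<integral>z. heat (\<tau> + r) F (couple w + sqrt h *\<^sub>R couple z) powr \<alpha>
        * heat (\<tau> + r) G (fst w + sqrt h *\<^sub>R fst z) powr \<beta> \<partial>borel_gaussian)"
      by (simp add: heat_def[of h] \<Phi>_def couple_add_scaleR)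
    also have "\<dots> \<le> heat h (heat (\<tau> + r) F) (couple w) powr \<alpha> * heat h (heat (\<tau> + r) G) (fst w) powr \<beta> + C * sqrt h ^ 3"
      by (rule C(2)) (use hF hG la bF bG that in auto)
    also have "\<dots> = \<Phi> (r + h) w + C * sqrt h ^ 3"
      using heat_heat[OF \<open>F \<in> _\<close> bF, where r=h and h="\<tau> + r"] heat_heat[OF \<open>G \<in> _\<close> bG, where r=h and h="\<tau> + r"] that \<tau>
      by (simp add: \<Phi>_def add_ac)
    finally show ?thesis .
  qed
  have main: "heat 1 (\<Phi> 0) 0 \<le> \<Phi> 1 0 + C / sqrt (real n)" if n: "0 < n" for n :: nat
  proof -
    define h where "h = 1 / real n"
    have h: "0 \<le> h" "h \<le> 1" "real n * h = 1" using n by (auto simp: h_def)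
    \<comment> \<open>Telescoping: each step moves an amount h of time from the outer averaging to
      the evolution of F and G, at the price of one error term.\<close>
    have "heat 1 (\<Phi> 0) 0 \<le> heat (1 - real k * h) (\<Phi> (real k * h)) 0 + real k * (C * sqrt h ^ 3)" if "k \<le> n" for k
      using that
    proof (induction k)
      case (Suc k)
      define r where "r = 1 - real (Suc k) * h"
      have r: "0 \<le> r" "1 - real k * h = r + h"
      proof -
        have "real (Suc k) * h \<le> real n * h"
          using Suc.prems h by (intro mult_right_mono) auto
        then show "0 \<le> r" using h by (simp add: r_def)
        show "1 - real k * h = r + h" by (simp add: r_def algebra_simps)
      qed
      have "heat (r + h) (\<Phi> (real k * h)) 0 = heat r (heat h (\<Phi> (real k * h))) 0"
        by (rule heat_heat[OF _ \<Phi>b r(1) h(1), symmetric]) measurable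
      also have "\<dots> \<le> heat r (\<Phi> (real k * h + h)) 0 + C * sqrt h ^ 3"
      proof (rule heat_mono_const[where M=MM])
        show "\<bar>heat h (\<Phi> (real k * h)) y\<bar> \<le> MM" for y
          by (rule heat_abs_le[OF _ \<Phi>b]) measurable
        show "heat h (\<Phi> (real k * h)) y \<le> \<Phi> (real k * h + h) y + C * sqrt h ^ 3" for y
          using h by (intro step) auto
      qed (measurable, rule \<Phi>b)
      finally show ?case
        using Suc h unfolding r(2) r_def[symmetric] by (simp add: algebra_simps)
    qed simp
    from this[of n] have "heat 1 (\<Phi> 0) 0 \<le> heat 0 (\<Phi> 1) 0 + real n * (C * sqrt h ^ 3)"
      by (simp add: h)
    \<comment> \<open>Since n h = 1, the n errors of order h^(3/2) add up to order sqrt h.\<close>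
    also have "real n * (C * sqrt h ^ 3) = (real n * h) * C * sqrt h"
      using h(1) by (simp add: power3_eq_cube)
    also have "\<dots> = C / sqrt (real n)"
      unfolding h(3) by (simp add: h_def real_sqrt_divide)
    finally show ?thesis by simp
  qed
  have "heat 1 (\<Phi> 0) 0 \<le> \<Phi> 1 0"
  proof (rule tendsto_lowerbound)
    have "(\<lambda>n. \<Phi> 1 0 + C / sqrt (real n)) \<longlonglongrightarrow> \<Phi> 1 0 + 0"
      by (intro tendsto_intros tendsto_divide_0[OF tendsto_const] filterlim_at_top_imp_at_infinity
          filterlim_compose[OF sqrt_at_top] filterlim_real_sequentially)
    then show "(\<lambda>n. \<Phi> 1 0 + C / sqrt (real n)) \<longlonglongrightarrow> \<Phi> 1 0" by simp
    show "\<forall>\<^sub>F n in sequentially. heat 1 (\<Phi> 0) 0 \<le> \<Phi> 1 0 + C / sqrt (real n)"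
      using eventually_gt_at_top[of 0] by eventually_elim (rule main)
  qed simp
  then show ?thesis by (simp add: heat_def[of 1] \<Phi>_def)
qed

lemma heat_tendsto:
  fixes f :: "'a::euclidean_space \<Rightarrow> real"
  assumes "continuous_on UNIV f" and "\<And>y. \<bar>f y\<bar> \<le> M" and "r \<longlonglongrightarrow> r0"
  shows "(\<lambda>n. heat (r n) f x) \<longlonglongrightarrow> heat r0 f x"
  unfolding heat_def
proof (rule integral_dominated_convergence[where w="\<lambda>_. M"])
  have [measurable]: "f \<in> borel_measurable borel" using assms(1) by (rule borel_measurable_continuous_onI)
  show "(\<lambda>y. f (x + sqrt r0 *\<^sub>R y)) \<in> borel_measurable borel_gaussian"
    "\<And>n. (\<lambda>y. f (x + sqrt (r n) *\<^sub>R y)) \<in> borel_measurable borel_gaussian" by measurable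
  show "AE y in borel_gaussian. (\<lambda>n. f (x + sqrt (r n) *\<^sub>R y)) \<longlonglongrightarrow> f (x + sqrt r0 *\<^sub>R y)"
    using assms(1) by (intro AE_I2 continuous_on_tendsto_compose[OF assms(1)] tendsto_intros assms(3)) auto
qed (use assms(2) in auto)

text \<open>The limit \<tau> \<rightarrow> 0 of the smoothed inequality; continuity of F and G gives
  the pointwise convergence. The means on the right are \<open>heat 1\<close> at the origin.\<close>

lemma couple_powr_le:
  fixes F G :: "'a::euclidean_space \<Rightarrow> real"
  assumes cont: "continuous_on UNIV F" "continuous_on UNIV G"
    and m: "0 < m" and F: "\<And>z. m \<le> F z" "\<And>z. F z \<le> M" and G: "\<And>z. m \<le> G z" "\<And>z. G z \<le> M"
    and ab: "0 \<le> \<alpha>" "\<alpha> \<le> 1" "0 \<le> \<beta>" "\<beta> \<le> 1" "\<rho>\<^sup>2 * \<alpha> * \<beta> \<le> (1 - \<alpha>) * (1 - \<beta>)"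
  shows "(\<integral>w. F (couple w) powr \<alpha> * G (fst w) powr \<beta> \<partial>borel_gaussian)
    \<le> (\<integral>y. F y \<partial>borel_gaussian) powr \<alpha> * (\<integral>y. G y \<partial>borel_gaussian) powr \<beta>"
proof -
  have [measurable]: "F \<in> borel_measurable borel" "G \<in> borel_measurable borel"
    using cont by (auto intro: borel_measurable_continuous_onI)
  have bF: "\<bar>F z\<bar> \<le> M" and bG: "\<bar>G z\<bar> \<le> M" for z
    using F[of z] G[of z] m by auto
  note hF = heat_le[OF \<open>F \<in> _\<close> F] and hG = heat_le[OF \<open>G \<in> _\<close> G]
  have "(\<lambda>w. heat t F (couple w) powr \<alpha> * heat t G (fst w) powr \<beta>) \<in> borel_measurable borel" for t
    by measurable
  then have meas: "(\<lambda>w. heat t F (couple w) powr \<alpha> * heat t G (fst w) powr \<beta>) \<in> borel_measurable borel_gaussian" for t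
    by (simp cong: measurable_cong_sets)
  define \<tau> where "\<tau> n = inverse (real (Suc n))" for n
  have \<tau>: "\<tau> \<longlonglongrightarrow> 0" unfolding \<tau>_def by (rule LIMSEQ_inverse_real_of_nat)
  have \<tau>1: "(\<lambda>n. \<tau> n + 1) \<longlonglongrightarrow> 1" using tendsto_add[OF \<tau> tendsto_const[of 1]] by simp
  have "heat 1 F 0 powr \<alpha> * heat 1 G 0 powr \<beta> \<ge> (\<integral>w. heat 0 F (couple w) powr \<alpha> * heat 0 G (fst w) powr \<beta> \<partial>borel_gaussian)"
  proof (rule LIMSEQ_le)
    show "(\<lambda>n. heat (\<tau> n + 1) F 0 powr \<alpha> * heat (\<tau> n + 1) G 0 powr \<beta>) \<longlonglongrightarrow> heat 1 F 0 powr \<alpha> * heat 1 G 0 powr \<beta>"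
      using hF(2)[of 1 0] hG(2)[of 1 0] m
      by (intro tendsto_intros heat_tendsto[OF cont(1) bF \<tau>1] heat_tendsto[OF cont(2) bG \<tau>1]) auto
    show "(\<lambda>n. \<integral>w. heat (\<tau> n) F (couple w) powr \<alpha> * heat (\<tau> n) G (fst w) powr \<beta> \<partial>borel_gaussian)
      \<longlonglongrightarrow> (\<integral>w. heat 0 F (couple w) powr \<alpha> * heat 0 G (fst w) powr \<beta> \<partial>borel_gaussian)"
    proof (rule integral_dominated_convergence[where w="\<lambda>_. M powr \<alpha> * M powr \<beta>"])
      show "AE w in borel_gaussian. (\<lambda>n. heat (\<tau> n) F (couple w) powr \<alpha> * heat (\<tau> n) G (fst w) powr \<beta>)
        \<longlonglongrightarrow> heat 0 F (couple w) powr \<alpha> * heat 0 G (fst w) powr \<beta>"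
      proof (rule AE_I2)
        fix w
        show "(\<lambda>n. heat (\<tau> n) F (couple w) powr \<alpha> * heat (\<tau> n) G (fst w) powr \<beta>)
          \<longlonglongrightarrow> heat 0 F (couple w) powr \<alpha> * heat 0 G (fst w) powr \<beta>"
          using hF(2)[of 0 "couple w"] hG(2)[of 0 "fst w"] m
          by (intro tendsto_intros heat_tendsto[OF cont(1) bF \<tau>] heat_tendsto[OF cont(2) bG \<tau>]) auto
      qed
      fix n
      show "AE w in borel_gaussian. norm (heat (\<tau> n) F (couple w) powr \<alpha> * heat (\<tau> n) G (fst w) powr \<beta>) \<le> M powr \<alpha> * M powr \<beta>"
      proof (rule AE_I2)
        fix w
        show "norm (heat (\<tau> n) F (couple w) powr \<alpha> * heat (\<tau> n) G (fst w) powr \<beta>) \<le> M powr \<alpha> * M powr \<beta>"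
          using hF[of "\<tau> n" "couple w"] hG[of "\<tau> n" "fst w"] m ab
          by (auto simp: abs_mult intro!: mult_mono powr_mono2)
      qed
    qed (simp_all add: meas)
    show "\<exists>N. \<forall>n\<ge>N. (\<integral>w. heat (\<tau> n) F (couple w) powr \<alpha> * heat (\<tau> n) G (fst w) powr \<beta> \<partial>borel_gaussian)
      \<le> heat (\<tau> n + 1) F 0 powr \<alpha> * heat (\<tau> n + 1) G 0 powr \<beta>"
      by (intro exI allI impI couple_heat_smooth[OF _ _ m F G ab]) (auto simp: \<tau>_def)
  qed
  then show ?thesis by (simp add: heat_def[of 1])
qed

end

subsection \<open>The Ornstein--Uhlenbeck semigroup\<close>

lemma integral_gaussian_borel:
  fixes f :: "'a::euclidean_space \<Rightarrow> real"
  assumes [measurable]: "f \<in> borel_measurable borel"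
  shows "(\<integral>y. f y \<partial>gaussian) = (\<integral>y. f y \<partial>borel_gaussian)"
proof -
  have [measurable]: "f \<in> borel_measurable lebesgue" "(gauss_density :: 'a \<Rightarrow> real) \<in> borel_measurable lebesgue"
    by (simp_all add: measurable_completion)
  have "(\<integral>y. f y \<partial>gaussian) = (\<integral>y. gauss_density y * f y \<partial>lebesgue)"
    unfolding gaussian_def gauss_density_def[symmetric] by (subst integral_density) auto
  also have "\<dots> = (\<integral>y. gauss_density y * f y \<partial>lborel)"
    by (rule integral_completion) measurable
  finally show ?thesis by (simp add: integral_borel_gaussian_density)
qed

text \<open>Noise of variance 1 - e^(-2s) around a contracted point: bounds, continuity and the
  semigroup law carry over from \<open>heat\<close>.\<close>

lemma ornstein_uhlenbeck_eq_heat: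
  assumes [measurable]: "f \<in> borel_measurable borel"
  shows "ornstein_uhlenbeck s f x = heat (1 - exp (- 2 * s)) f (exp (- s) *\<^sub>R x)"
  unfolding ornstein_uhlenbeck_def heat_def by (rule integral_gaussian_borel) measurable

lemma one_minus_exp_bounds:
  fixes s :: real
  assumes "0 < s"
  shows "0 < 1 - exp (- 2 * s)" "0 \<le> 1 - exp (- 2 * s)" "sqrt (1 - exp (- 2 * s)) \<noteq> 0"
proof -
  show "0 < 1 - exp (- 2 * s)" using assms by simp
  then show "0 \<le> 1 - exp (- 2 * s)" "sqrt (1 - exp (- 2 * s)) \<noteq> 0" by auto
qed

text \<open>For t > 0 the affine map in the integrand is invertible and pulls null sets back to null
  sets. Hence equality holds at every x, and Lebesgue measurable data can be replaced by Borel
  data.\<close>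

lemma ornstein_uhlenbeck_cong_AE:
  fixes g g' :: "'a::euclidean_space \<Rightarrow> real"
  assumes g: "g \<in> borel_measurable lebesgue" and [measurable]: "g' \<in> borel_measurable borel"
    and ae: "AE x in lborel. g x = g' x" and "0 < t"
  shows "ornstein_uhlenbeck t g x = ornstein_uhlenbeck t g' x"
proof -
  define c where "c = sqrt (1 - exp (- 2 * t))"
  have c: "c \<noteq> 0" unfolding c_def by (rule one_minus_exp_bounds) fact
  define a where "a = exp (- t) *\<^sub>R x"
  have aff: "(\<lambda>y::'a. a + c *\<^sub>R y) \<in> lebesgue \<rightarrow>\<^sub>M lebesgue"
    using lebesgue_affine_measurable[of "\<lambda>_. c" a] c
    unfolding scaleR_scaleR[symmetric] scaleR_sum_right[symmetric] euclidean_representation by simp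
  have m1: "(\<lambda>y. g (a + c *\<^sub>R y)) \<in> borel_measurable lebesgue"
    by (rule measurable_compose[OF aff g])
  have m2: "(\<lambda>y. g' (a + c *\<^sub>R y)) \<in> borel_measurable lebesgue"
    by (rule measurable_completion) measurable
  have "AE y in lebesgue. g (a + c *\<^sub>R y) = g' (a + c *\<^sub>R y)"
    by (rule AE_completion) (rule AE_lborel_affine[OF ae c])
  then have "AE y in gaussian. g (a + c *\<^sub>R y) = g' (a + c *\<^sub>R y)"
    unfolding gaussian_def gauss_density_def[symmetric]
    by (subst AE_density) (auto simp: measurable_completion)
  then show ?thesis
    unfolding ornstein_uhlenbeck_def c_def[symmetric] a_def[symmetric]
    by (intro integral_cong_AE) (use m1 m2 in \<open>simp_all add: gaussian_def\<close>)
qed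

text \<open>Clipping to [0, M] makes the bounds hold everywhere instead of almost
  everywhere.\<close>

lemma borel_version:
  fixes g :: "'a::euclidean_space \<Rightarrow> real"
  assumes g: "g \<in> borel_measurable lebesgue" and "\<And>x. 0 \<le> g x" "\<And>x. g x \<le> M"
  obtains g' where "g' \<in> borel_measurable borel" "\<And>x. 0 \<le> g' x" "\<And>x. g' x \<le> M"
    "AE x in lborel. g x = g' x"
proof -
  obtain f where [measurable]: "f \<in> borel_measurable lborel" and f: "AE x in lborel. g x = f x"
    using completion_ex_borel_measurable_real[OF g] by blast
  have M: "0 \<le> M" using assms(2,3)[of 0] by linarith
  show ?thesis
  proof (rule that[of "\<lambda>x. max 0 (min M (f x))"])
    show "AE x in lborel. g x = max 0 (min M (f x))"
      using f by eventually_elim (metis assms(2,3) max_def min_def order_antisym)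
  qed (use M in auto)
qed

section \<open>Positivity and continuity of evolved functions\<close>

lemma integral_borel_gaussian_pos:
  fixes f :: "'a::euclidean_space \<Rightarrow> real"
  assumes "integrable borel_gaussian f" "AE y in borel_gaussian. 0 < f y"
  shows "0 < (\<integral>y. f y \<partial>borel_gaussian)"
  using borel_gaussian.expectation_greater[OF assms] .

text \<open>A vanishing average of a nonnegative function against an everywhere positive density
  forces it to vanish almost everywhere; undoing the affine map transfers this to
  \<open>g\<close>.\<close>

lemma heat_pos:
  fixes g :: "'a::euclidean_space \<Rightarrow> real"
  assumes [measurable]: "g \<in> borel_measurable borel" and g: "\<And>y. 0 \<le> g y" "\<And>y. g y \<le> M"
    and nz: "\<not> (AE y in lborel. g y = 0)" and "0 < r"
  shows "0 < heat r g x"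
proof (rule ccontr)
  assume "\<not> 0 < heat r g x"
  moreover have "0 \<le> heat r g x" by (rule heat_le(2)[OF _ g]) measurable
  ultimately have 0: "(\<integral>y. g (x + sqrt r *\<^sub>R y) \<partial>borel_gaussian) = 0" by (simp add: heat_def)
  have "integrable borel_gaussian (\<lambda>y. g (x + sqrt r *\<^sub>R y))"
    by (rule integrable_heat[where M=M]) (use g in \<open>auto simp: abs_le_iff intro: order_trans\<close>)
  with 0 have "AE y in borel_gaussian. g (x + sqrt r *\<^sub>R y) = 0"
    using integral_nonneg_eq_0_iff_AE[of borel_gaussian "\<lambda>y. g (x + sqrt r *\<^sub>R y)"] g by simp
  then have "AE y in lborel. g (x + sqrt r *\<^sub>R y) = 0"
    unfolding borel_gaussian_def by (subst (asm) AE_density) auto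
  then have "AE y in lborel. g (x + sqrt r *\<^sub>R (- (1 / sqrt r) *\<^sub>R x + (1 / sqrt r) *\<^sub>R y)) = 0"
    by (rule AE_lborel_affine) (use \<open>0 < r\<close> in simp)
  moreover have "x + sqrt r *\<^sub>R (- (1 / sqrt r) *\<^sub>R x + (1 / sqrt r) *\<^sub>R y) = y" for y
    using \<open>0 < r\<close> by (simp add: scaleR_diff_right)
  ultimately show False using nz by simp
qed

lemma linear_approx_continuous:
  fixes f :: "'a::euclidean_space \<Rightarrow> real"
  assumes "linear_approx K f"
  shows "continuous_on UNIV f"
proof (intro continuous_at_imp_continuous_on ballI)
  fix x :: 'a
  obtain a where a: "norm a \<le> K" "\<And>w. \<bar>f (x + w) - f x - a \<bullet> w\<bar> \<le> K * (norm w)\<^sup>2"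
    using assms unfolding linear_approx_def by blast
  have "((\<lambda>w. f (x + w) - f x - a \<bullet> w) \<longlongrightarrow> 0) (at 0)"
  proof (rule Lim_null_comparison)
    show "\<forall>\<^sub>F w in at 0. norm (f (x + w) - f x - a \<bullet> w) \<le> K * (norm w)\<^sup>2"
      using a(2) by simp
    have "isCont (\<lambda>w::'a. K * (norm w)\<^sup>2) 0"
      by (intro continuous_intros)
    then show "((\<lambda>w::'a. K * (norm w)\<^sup>2) \<longlongrightarrow> 0) (at 0)" by (simp add: isCont_def)
  qed
  moreover have "((\<lambda>w. f x + a \<bullet> w) \<longlongrightarrow> f x + a \<bullet> 0) (at 0)"
    by (intro tendsto_intros)
  ultimately have "((\<lambda>w. (f (x + w) - f x - a \<bullet> w) + (f x + a \<bullet> w)) \<longlongrightarrow> 0 + (f x + a \<bullet> 0)) (at 0)"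
    by (rule tendsto_add)
  then show "isCont f x"
    by (simp add: isCont_iff)
qed

lemma heat_continuous:
  fixes g :: "'a::euclidean_space \<Rightarrow> real"
  assumes "g \<in> borel_measurable borel" "\<And>y. \<bar>g y\<bar> \<le> M" "0 < \<tau>"
  shows "continuous_on UNIV (heat \<tau> g)"
proof -
  have "0 \<le> M" using assms(2)[of 0] by linarith
  then obtain K where "linear_approx K (heat \<tau> g)"
    using heat_linear_approx[where 'a='a, OF assms(3), of M] assms(1,2) by metis
  then show ?thesis by (rule linear_approx_continuous)
qed

section \<open>Invariance of the Gaussian measure and the semigroup law\<close>

lemma Fubini_borel_gaussian:
  fixes f :: "'a::euclidean_space \<times> 'b::euclidean_space \<Rightarrow> real"
  assumes "f \<in> borel_measurable borel" "\<And>w. \<bar>f w\<bar> \<le> M"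
  shows "(\<integral>x. \<integral>y. f (x, y) \<partial>borel_gaussian \<partial>borel_gaussian) = (\<integral>w. f w \<partial>borel_gaussian)"
    "(\<integral>y. \<integral>x. f (x, y) \<partial>borel_gaussian \<partial>borel_gaussian) = (\<integral>w. f w \<partial>borel_gaussian)"
proof -
  have i: "integrable (borel_gaussian \<Otimes>\<^sub>M borel_gaussian) f"
    unfolding borel_gaussian_pair_eq by (rule integrable_borel_gaussian_bounded) fact+
  show 1: "(\<integral>x. \<integral>y. f (x, y) \<partial>borel_gaussian \<partial>borel_gaussian) = (\<integral>w. f w \<partial>borel_gaussian)"
    using borel_gaussian_pair.integral_fst'[OF i] by (simp only: borel_gaussian_pair_eq)
  show "(\<integral>y. \<integral>x. f (x, y) \<partial>borel_gaussian \<partial>borel_gaussian) = (\<integral>w. f w \<partial>borel_gaussian)"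
    using borel_gaussian_pair.Fubini_integral[of "\<lambda>x y. f (x, y)"] i 1 by simp
qed

text \<open>The squared weights of x and y add up to 1, so rotation invariance applies. This
  invariance is what turns the pointwise inequality into one between integrals.\<close>

lemma integral_ornstein_uhlenbeck:
  fixes f :: "'a::euclidean_space \<Rightarrow> real"
  assumes [measurable]: "f \<in> borel_measurable borel" and M: "\<And>y. \<bar>f y\<bar> \<le> M" and "0 < h"
  shows "(\<integral>x. ornstein_uhlenbeck h f x \<partial>borel_gaussian) = (\<integral>x. f x \<partial>borel_gaussian)"
proof -
  define c where "c = sqrt (1 - exp (- 2 * h))"
  have c: "c\<^sup>2 + (exp (- h))\<^sup>2 = 1" "0 < c"
    using one_minus_exp_bounds[OF \<open>0 < h\<close>] by (auto simp: c_def exp_double[symmetric])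
  have "(\<integral>x. ornstein_uhlenbeck h f x \<partial>borel_gaussian) =
    (\<integral>x. \<integral>y. f (exp (- h) *\<^sub>R fst (x, y) + c *\<^sub>R snd (x, y)) \<partial>borel_gaussian \<partial>borel_gaussian)"
    by (simp add: ornstein_uhlenbeck_eq_heat heat_def c_def)
  also have "\<dots> = (\<integral>w. f (exp (- h) *\<^sub>R fst w + c *\<^sub>R snd w) \<partial>borel_gaussian)"
    by (rule Fubini_borel_gaussian(1)) (measurable, rule M)
  also have "\<dots> = (\<integral>x. f x \<partial>borel_gaussian)"
    by (rule integral_borel_gaussian_rotate[OF c]) measurable
  finally show ?thesis .
qed

lemma ornstein_uhlenbeck_measurable [measurable (raw)]:
  assumes [measurable]: "f \<in> borel_measurable borel"
  shows "ornstein_uhlenbeck s f \<in> borel_measurable borel"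
proof -
  have eq: "ornstein_uhlenbeck s f = (\<lambda>x. heat (1 - exp (- 2 * s)) f (exp (- s) *\<^sub>R x))"
    by (simp add: fun_eq_iff ornstein_uhlenbeck_eq_heat)
  have [measurable]: "heat (1 - exp (- 2 * s)) f \<in> borel_measurable borel" by measurable
  show ?thesis unfolding eq by measurable
qed

lemma ornstein_uhlenbeck_le:
  assumes [measurable]: "f \<in> borel_measurable borel" and "\<And>y. m \<le> f y" "\<And>y. f y \<le> M"
  shows "ornstein_uhlenbeck s f x \<le> M" "m \<le> ornstein_uhlenbeck s f x"
  using heat_le[OF assms] by (simp_all add: ornstein_uhlenbeck_eq_heat)

lemma ornstein_uhlenbeck_continuous:
  fixes f :: "'a::euclidean_space \<Rightarrow> real"
  assumes [measurable]: "f \<in> borel_measurable borel" and M: "\<And>y. \<bar>f y\<bar> \<le> M" and "0 < s"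
  shows "continuous_on UNIV (ornstein_uhlenbeck s f)"
proof -
  have eq: "ornstein_uhlenbeck s f = (\<lambda>x. heat (1 - exp (- 2 * s)) f (exp (- s) *\<^sub>R x))"
    by (simp add: fun_eq_iff ornstein_uhlenbeck_eq_heat)
  have c: "continuous_on UNIV (heat (1 - exp (- 2 * s)) f)"
    by (rule heat_continuous[OF _ M one_minus_exp_bounds(1)[OF \<open>0 < s\<close>]]) measurable
  show ?thesis
    unfolding eq by (rule continuous_on_compose2[OF c]) (auto intro!: continuous_intros)
qed

text \<open>Pulling the contraction e^(-t) through the outer noise scales its variance by e^(-2t),
  and e^(-2t) (1 - e^(-2h)) + 1 - e^(-2t) = 1 - e^(-2(h+t)).\<close>

lemma ornstein_uhlenbeck_compose:
  fixes f :: "'a::euclidean_space \<Rightarrow> real"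
  assumes [measurable]: "f \<in> borel_measurable borel" and M: "\<And>y. \<bar>f y\<bar> \<le> M" and "0 < h" "0 < t"
  shows "ornstein_uhlenbeck h (ornstein_uhlenbeck t f) x = ornstein_uhlenbeck (h + t) f x"
proof -
  define T where "T = 1 - exp (- 2 * t)"
  define H where "H = 1 - exp (- 2 * h)"
  have pos: "0 \<le> T" "0 \<le> H" unfolding T_def H_def using assms by auto
  have r: "sqrt ((exp (- t))\<^sup>2 * H) = exp (- t) * sqrt H"
    by (simp add: real_sqrt_mult)
  have "ornstein_uhlenbeck h (ornstein_uhlenbeck t f) x =
      (\<integral>y. heat T f (exp (- t) *\<^sub>R (exp (- h) *\<^sub>R x + sqrt H *\<^sub>R y)) \<partial>borel_gaussian)"
    by (simp add: ornstein_uhlenbeck_eq_heat heat_def[of "1 - exp (- (2 * h))"] T_def H_def)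
  also have "\<dots> = heat ((exp (- t))\<^sup>2 * H) (heat T f) (exp (- t) *\<^sub>R exp (- h) *\<^sub>R x)"
    by (simp add: heat_def[of "(exp (- t))\<^sup>2 * H"] r scaleR_add_right)
  also have "\<dots> = heat ((exp (- t))\<^sup>2 * H + T) f (exp (- t) *\<^sub>R exp (- h) *\<^sub>R x)"
    using pos by (intro heat_heat[OF _ M]) auto
  also have "(exp (- t))\<^sup>2 * H + T = 1 - exp (- 2 * (h + t))"
    by (simp add: H_def T_def exp_double[symmetric] algebra_simps mult_exp_exp)
  also have "exp (- t) *\<^sub>R exp (- h) *\<^sub>R x = exp (- (h + t)) *\<^sub>R x"
    by (simp add: mult_exp_exp add.commute)
  finally show ?thesis by (simp only: ornstein_uhlenbeck_eq_heat[OF assms(1), of "h + t"])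
qed

text \<open>The inner average of \<open>e\<^sup>s\<^sup>L f\<close> splits its Gaussian noise into an outer part, shared by both
  sides, and an inner part to which the two-function inequality applies; this plays the role of
  Minkowski's inequality.\<close>
lemma ornstein_uhlenbeck_supersolution:
  fixes v :: "'a::euclidean_space \<Rightarrow> real" and p q s h m M :: real
  assumes pq: "1 < p" "p < q" and s: "0 < s" "exp (2 * s) = (q - 1) / (p - 1)" and h: "0 < h"
    and cont: "continuous_on UNIV v" and m: "0 < m" and v: "\<And>y. m \<le> v y" "\<And>y. v y \<le> M"
  shows "ornstein_uhlenbeck h (\<lambda>y. ornstein_uhlenbeck s (\<lambda>z. v z powr (1 / p)) y powr q) x
    \<le> ornstein_uhlenbeck s (\<lambda>z. ornstein_uhlenbeck h v z powr (1 / p)) x powr q"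
proof -
  have [measurable]: "v \<in> borel_measurable borel" using cont by (rule borel_measurable_continuous_onI)
  define \<rho> where "\<rho> = exp (- s)"
  define \<sigma> where "\<sigma> = sqrt (1 - exp (- 2 * s))"
  define b where "b = sqrt (1 - exp (- 2 * h))"
  \<comment> \<open>The noise of weight \<sigma> in e^(sL) splits into weights \<open>a\<close>
    (outer variable z) and \<open>b * \<sigma>\<close> (inner variable w). With this
    \<open>a\<close>, the centre \<open>x1 + a *\<^sub>R z\<close> is e^(-h) times e^(-s) x +
    \<sigma> z, the point at which e^(hL) v is evaluated on the right.\<close>
  define a where "a = exp (- h) * \<sigma>"
  define x1 where "x1 = exp (- s) *\<^sub>R exp (- h) *\<^sub>R x"
  define \<alpha> where "\<alpha> = 1 / p"
  define \<beta> where "\<beta> = 1 - 1 / q"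
  define f where "f z = v z powr \<alpha>" for z
  define H where "H y = ornstein_uhlenbeck s f (exp (- h) *\<^sub>R x + b *\<^sub>R y)" for y
  define N where "N = ornstein_uhlenbeck s (\<lambda>z. ornstein_uhlenbeck h v z powr (1 / p)) x"
  define T where "T = (\<integral>y. H y powr q \<partial>borel_gaussian)"
  define l where "l = m powr \<alpha>"
  define L where "L = M powr \<alpha>"
  note sb = one_minus_exp_bounds[OF s(1)] and hb = one_minus_exp_bounds[OF h]
  have rs: "\<rho>\<^sup>2 + \<sigma>\<^sup>2 = 1" "0 < \<sigma>"
    using sb by (auto simp: \<rho>_def \<sigma>_def exp_double[symmetric])
  have b: "0 < b" using hb by (simp add: b_def)
  have ab: "0 \<le> \<alpha>" "\<alpha> \<le> 1" "0 \<le> \<beta>" "\<beta> \<le> 1" using pq by (auto simp: \<alpha>_def \<beta>_def)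
  have "\<rho>\<^sup>2 = inverse (exp (2 * s))"
    by (simp add: \<rho>_def exp_double exp_minus power_inverse)
  then have r2: "\<rho>\<^sup>2 = (p - 1) / (q - 1)" by (simp add: s(2))
  \<comment> \<open>Both sides equal (p - 1)/(p q): the prescribed s is the borderline time.\<close>
  have cond: "\<rho>\<^sup>2 * \<alpha> * \<beta> \<le> (1 - \<alpha>) * (1 - \<beta>)"
    unfolding r2 \<alpha>_def \<beta>_def using pq by (simp add: field_simps)
  have [measurable]: "f \<in> borel_measurable borel" unfolding f_def by measurable
  have l0: "0 < l" using m by (simp add: l_def)
  have L0: "0 \<le> L" by (simp add: L_def)
  have fb: "l \<le> f z" "f z \<le> L" for z
    using v[of z] m ab by (auto simp: f_def l_def L_def intro!: powr_mono2)
  have fabs: "\<bar>f z\<bar> \<le> L" for z using fb[of z] l0 by auto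
  have Hb: "l \<le> H y" "H y \<le> L" for y
    unfolding H_def by (rule ornstein_uhlenbeck_le[OF _ fb]; measurable)+
  have Hcont: "continuous_on UNIV H"
    unfolding H_def
    by (rule continuous_on_compose2[OF ornstein_uhlenbeck_continuous[OF _ fabs s(1)]])
       (auto intro!: continuous_intros)
  have [measurable]: "H \<in> borel_measurable borel" using Hcont by (rule borel_measurable_continuous_onI)
  have H0: "0 < H y" for y using Hb(1)[of y] l0 by linarith
  have Heq: "H y = (\<integral>z. \<integral>w. f (x1 + \<rho> *\<^sub>R b *\<^sub>R y + a *\<^sub>R z + (b * \<sigma>) *\<^sub>R w) \<partial>borel_gaussian \<partial>borel_gaussian)" for y
  proof -
    have "a\<^sup>2 + (b * \<sigma>)\<^sup>2 = \<sigma>\<^sup>2 * ((exp (- h))\<^sup>2 + b\<^sup>2)"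
      by (simp add: a_def power_mult_distrib algebra_simps)
    also have "(exp (- h))\<^sup>2 + b\<^sup>2 = 1"
      using hb by (simp add: b_def exp_double[symmetric])
    finally have "1 - exp (- 2 * s) = a\<^sup>2 + (b * \<sigma>)\<^sup>2"
      using sb by (simp add: \<sigma>_def)
    then have "H y = heat (a\<^sup>2 + (b * \<sigma>)\<^sup>2) f (x1 + \<rho> *\<^sub>R b *\<^sub>R y)"
      by (simp add: H_def ornstein_uhlenbeck_eq_heat x1_def \<rho>_def scaleR_add_right)
    also have "\<dots> = heat (a\<^sup>2) (heat ((b * \<sigma>)\<^sup>2) f) (x1 + \<rho> *\<^sub>R b *\<^sub>R y)"
      by (rule heat_heat[symmetric, OF _ fabs]) auto
    finally show ?thesis
      using b rs(2) by (simp add: heat_def a_def)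
  qed
  have T: "0 < T"
    unfolding T_def
  proof (rule integral_borel_gaussian_pos)
    show "integrable borel_gaussian (\<lambda>y. H y powr q)"
    proof (rule integrable_borel_gaussian_bounded[where M="L powr q"])
      show "\<bar>H y powr q\<bar> \<le> L powr q" for y
        using Hb[of y] H0[of y] pq by (auto intro!: powr_mono2)
    qed measurable
  qed (use H0 in \<open>auto simp: less_imp_neq[symmetric]\<close>)
  \<comment> \<open>With z fixed, y and w enter v only through
    \<open>b *\<^sub>R couple \<rho> \<sigma> (y, w)\<close>, while H sees y alone: exactly the
    correlated pair. The exponents match because q \<beta> = q - 1.\<close>
  have inner: "(\<integral>y. (\<integral>w. f (x1 + \<rho> *\<^sub>R b *\<^sub>R y + a *\<^sub>R z + (b * \<sigma>) *\<^sub>R w) \<partial>borel_gaussian) * H y powr (q - 1) \<partial>borel_gaussian)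
     \<le> ornstein_uhlenbeck h v (exp (- s) *\<^sub>R x + \<sigma> *\<^sub>R z) powr \<alpha> * T powr \<beta>" for z
  proof -
    define F where "F y = v (x1 + a *\<^sub>R z + b *\<^sub>R y)" for y
    define G where "G y = H y powr q" for y
    have "(\<integral>y. (\<integral>w. f (x1 + \<rho> *\<^sub>R b *\<^sub>R y + a *\<^sub>R z + (b * \<sigma>) *\<^sub>R w) \<partial>borel_gaussian) * H y powr (q - 1) \<partial>borel_gaussian)
      = (\<integral>y. \<integral>w. F (couple \<rho> \<sigma> (y, w)) powr \<alpha> * G (fst (y, w)) powr \<beta> \<partial>borel_gaussian \<partial>borel_gaussian)"
    proof (rule Bochner_Integration.integral_cong[OF refl])
      fix y
      have "q * \<beta> = q - 1" using pq by (simp add: \<beta>_def field_simps)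
      then have "G y powr \<beta> = H y powr (q - 1)" by (simp add: G_def powr_powr)
      moreover have eqw: "x1 + \<rho> *\<^sub>R b *\<^sub>R y + a *\<^sub>R z + (b * \<sigma>) *\<^sub>R w = x1 + a *\<^sub>R z + b *\<^sub>R couple \<rho> \<sigma> (y, w)" for w
        using rs by (simp add: couple_def scaleR_add_right mult.commute)
      ultimately show "(\<integral>w. f (x1 + \<rho> *\<^sub>R b *\<^sub>R y + a *\<^sub>R z + (b * \<sigma>) *\<^sub>R w) \<partial>borel_gaussian) * H y powr (q - 1)
         = (\<integral>w. F (couple \<rho> \<sigma> (y, w)) powr \<alpha> * G (fst (y, w)) powr \<beta> \<partial>borel_gaussian)"
        unfolding eqw by (simp add: F_def f_def)
    qed
    also have "\<dots> = (\<integral>w. F (couple \<rho> \<sigma> w) powr \<alpha> * G (fst w) powr \<beta> \<partial>borel_gaussian)"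
    proof (rule Fubini_borel_gaussian(1)[where M="L * (L powr q) powr \<beta>"])
      have [measurable]: "couple \<rho> \<sigma> \<in> borel_measurable borel" by (rule couple_measurable[OF rs])
      show "(\<lambda>w. F (couple \<rho> \<sigma> w) powr \<alpha> * G (fst w) powr \<beta>) \<in> borel_measurable borel"
        unfolding F_def G_def by measurable
      fix w
      have "0 \<le> F (couple \<rho> \<sigma> w) powr \<alpha>" "F (couple \<rho> \<sigma> w) powr \<alpha> \<le> L"
        using fb(2) by (auto simp: F_def f_def)
      moreover have "G (fst w) powr \<beta> \<le> (L powr q) powr \<beta>"
        unfolding G_def using Hb[of "fst w"] H0[of "fst w"] pq ab by (intro powr_mono2) auto
      ultimately show "\<bar>F (couple \<rho> \<sigma> w) powr \<alpha> * G (fst w) powr \<beta>\<bar> \<le> L * (L powr q) powr \<beta>"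
        unfolding abs_mult using L0 by (intro mult_mono) auto
    qed
    also have "\<dots> \<le> (\<integral>y. F y \<partial>borel_gaussian) powr \<alpha> * (\<integral>y. G y \<partial>borel_gaussian) powr \<beta>"
    proof (rule couple_powr_le[OF rs])
      show "continuous_on UNIV F"
        unfolding F_def by (rule continuous_on_compose2[OF cont]) (auto intro!: continuous_intros)
      show "continuous_on UNIV G"
        unfolding G_def using H0 by (intro continuous_intros Hcont) (auto simp: less_imp_neq[symmetric])
      \<comment> \<open>One pair of bounds has to serve both F and G.\<close>
      show "0 < min m (l powr q)" using m l0 by simp
      show "min m (l powr q) \<le> F z" "F z \<le> max M (L powr q)" for z
        using v by (auto simp: F_def min.coboundedI1 max.coboundedI1)
      show "min m (l powr q) \<le> G z" "G z \<le> max M (L powr q)" for z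
        unfolding G_def using Hb[of z] l0 H0[of z] pq
        by (auto intro!: min.coboundedI2 max.coboundedI2 powr_mono2)
    qed (fact ab cond)+
    also have "(\<integral>y. F y \<partial>borel_gaussian) = ornstein_uhlenbeck h v (exp (- s) *\<^sub>R x + \<sigma> *\<^sub>R z)"
      by (simp add: ornstein_uhlenbeck_eq_heat heat_def F_def b_def x1_def a_def scaleR_add_right mult.commute)
    also have "(\<integral>y. G y \<partial>borel_gaussian) = T"
      by (simp add: T_def G_def)
    finally show ?thesis .
  qed
  define \<Psi> where "\<Psi> w = heat ((b * \<sigma>)\<^sup>2) f (x1 + \<rho> *\<^sub>R b *\<^sub>R fst w + a *\<^sub>R snd w) * H (fst w) powr (q - 1)" for w
  have \<Psi>eq: "\<Psi> (y, z) = (\<integral>w. f (x1 + \<rho> *\<^sub>R b *\<^sub>R y + a *\<^sub>R z + (b * \<sigma>) *\<^sub>R w) \<partial>borel_gaussian) * H y powr (q - 1)" for y z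
    using b rs(2) by (simp add: \<Psi>_def heat_def)
  have [measurable]: "heat ((b * \<sigma>)\<^sup>2) f \<in> borel_measurable borel"
    by measurable
  have \<Psi>m [measurable]: "\<Psi> \<in> borel_measurable borel"
    unfolding \<Psi>_def by measurable
  have \<Psi>b: "\<bar>\<Psi> w\<bar> \<le> L * L powr (q - 1)" for w
  proof -
    have "\<bar>heat ((b * \<sigma>)\<^sup>2) f (x1 + \<rho> *\<^sub>R b *\<^sub>R fst w + a *\<^sub>R snd w)\<bar> \<le> L"
      by (rule heat_abs_le[OF _ fabs]) measurable
    moreover have "H (fst w) powr (q - 1) \<le> L powr (q - 1)"
      using Hb[of "fst w"] H0[of "fst w"] pq by (intro powr_mono2) auto
    ultimately show ?thesis
      unfolding \<Psi>_def abs_mult by (intro mult_mono) (auto intro: order_trans[OF abs_ge_zero])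
  qed
  \<comment> \<open>One factor of H^q = H * H^(q-1) is expanded by \<open>Heq\<close>, so that the
    integration over z can be moved outside.\<close>
  have "T = (\<integral>y. \<integral>z. \<Psi> (y, z) \<partial>borel_gaussian \<partial>borel_gaussian)"
    unfolding T_def
  proof (rule Bochner_Integration.integral_cong[OF refl])
    fix y
    have "H y powr q = H y * H y powr (q - 1)"
      using H0[of y] powr_add[of "H y" 1 "q - 1"] by simp
    then show "H y powr q = (\<integral>z. \<Psi> (y, z) \<partial>borel_gaussian)"
      unfolding \<Psi>eq by (subst (asm) (2) Heq) simp
  qed
  also have "\<dots> = (\<integral>z. \<integral>y. \<Psi> (y, z) \<partial>borel_gaussian \<partial>borel_gaussian)"
    using Fubini_borel_gaussian[OF \<Psi>m \<Psi>b] by simp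
  also have "\<dots> \<le> (\<integral>z. ornstein_uhlenbeck h v (exp (- s) *\<^sub>R x + \<sigma> *\<^sub>R z) powr \<alpha> * T powr \<beta> \<partial>borel_gaussian)"
  proof (rule Bochner_Integration.integral_mono)
    show "integrable borel_gaussian (\<lambda>z. \<integral>y. \<Psi> (y, z) \<partial>borel_gaussian)"
    proof (rule integrable_borel_gaussian_bounded[where M="L * L powr (q - 1)"])
      fix z
      \<comment> \<open>A Gaussian mean is \<open>heat 1\<close> at the origin, so the bound for
        \<open>heat\<close> applies.\<close>
      have "\<bar>heat 1 (\<lambda>y. \<Psi> (y, z)) 0\<bar> \<le> L * L powr (q - 1)"
        by (rule heat_abs_le[OF _ \<Psi>b]) (simp add: \<Psi>_def)
      then show "\<bar>\<integral>y. \<Psi> (y, z) \<partial>borel_gaussian\<bar> \<le> L * L powr (q - 1)"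
        by (simp add: heat_def)
    qed (unfold \<Psi>_def fst_conv snd_conv, measurable)
    show "integrable borel_gaussian (\<lambda>z. ornstein_uhlenbeck h v (exp (- s) *\<^sub>R x + \<sigma> *\<^sub>R z) powr \<alpha> * T powr \<beta>)"
    proof (rule integrable_mult_left, rule integrable_borel_gaussian_bounded[where M=L])
      fix z
      show "\<bar>ornstein_uhlenbeck h v (exp (- s) *\<^sub>R x + \<sigma> *\<^sub>R z) powr \<alpha>\<bar> \<le> L"
        using ornstein_uhlenbeck_le[OF \<open>v \<in> _\<close> v, of h "exp (- s) *\<^sub>R x + \<sigma> *\<^sub>R z"] m ab
        by (auto simp: L_def intro!: powr_mono2)
    qed measurable
    show "(\<integral>y. \<Psi> (y, z) \<partial>borel_gaussian) \<le> ornstein_uhlenbeck h v (exp (- s) *\<^sub>R x + \<sigma> *\<^sub>R z) powr \<alpha> * T powr \<beta>" for z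
      using inner[of z] unfolding \<Psi>eq .
  qed
  also have "\<dots> = N * T powr \<beta>"
    by (simp add: N_def ornstein_uhlenbeck_eq_heat[of "\<lambda>z. ornstein_uhlenbeck h v z powr (1 / p)"] heat_def[of "1 - exp (- (2 * s))"] \<sigma>_def \<alpha>_def)
  finally have TN: "T \<le> N * T powr \<beta>" .
  \<comment> \<open>As T is positive and finite, T^\<beta> can be cancelled, leaving T^(1/q) \<le>
    N.\<close>
  have "T = T powr (1 / q) * T powr \<beta>"
    using T by (simp add: \<beta>_def powr_add[symmetric])
  with TN have "T powr (1 / q) * T powr \<beta> \<le> N * T powr \<beta>" by linarith
  then have "T powr (1 / q) \<le> N" using T by simp
  then have "(T powr (1 / q)) powr q \<le> N powr q"
    using pq by (intro powr_mono2) auto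
  then have "T \<le> N powr q" using T pq by (simp add: powr_powr)
  moreover have "ornstein_uhlenbeck h (\<lambda>y. ornstein_uhlenbeck s (\<lambda>z. v z powr (1 / p)) y powr q) x = T"
    by (simp add: ornstein_uhlenbeck_eq_heat[of "\<lambda>y. ornstein_uhlenbeck s (\<lambda>z. v z powr (1 / p)) y powr q"] heat_def[of "1 - exp (- (2 * h))"]
        T_def H_def b_def f_def[abs_def] \<alpha>_def)
  ultimately show ?thesis by (simp add: N_def)
qed

text \<open>Dominated convergence twice, inside the semigroup and in the outer integral. The bound
  \<open>e n \<le> 1\<close> gives the common majorant, and positive exponents keep the powers
  continuous where f vanishes.\<close>

lemma ornstein_uhlenbeck_powr_tendsto:
  fixes f :: "'a::euclidean_space \<Rightarrow> real"
  assumes [measurable]: "f \<in> borel_measurable borel" and f: "\<And>y. 0 \<le> f y" "\<And>y. f y \<le> M"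
    and p: "0 < p" and q: "0 < q"
    and e: "e \<longlonglongrightarrow> 0" "\<And>n. 0 \<le> e n" "\<And>n. e n \<le> 1"
  shows "(\<lambda>n. \<integral>x. ornstein_uhlenbeck s (\<lambda>y. (f y + e n) powr (1 / p)) x powr q \<partial>borel_gaussian)
    \<longlonglongrightarrow> (\<integral>x. ornstein_uhlenbeck s (\<lambda>y. f y powr (1 / p)) x powr q \<partial>borel_gaussian)"
proof (rule integral_dominated_convergence[where w="\<lambda>_. ((M + 1) powr (1 / p)) powr q"])
  define fe where "fe n y = (f y + e n) powr (1 / p)" for n y
  have [measurable]: "fe n \<in> borel_measurable borel" for n unfolding fe_def by measurable
  have fe: "0 \<le> fe n y" "fe n y \<le> (M + 1) powr (1 / p)" for n y
    using f[of y] e(2,3)[of n] p by (auto simp: fe_def intro!: powr_mono2)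
  have ou: "0 \<le> ornstein_uhlenbeck s (fe n) x" "ornstein_uhlenbeck s (fe n) x \<le> (M + 1) powr (1 / p)" for n x
    by (rule ornstein_uhlenbeck_le[OF _ fe]; measurable)+
  show "AE x in borel_gaussian. (\<lambda>n. ornstein_uhlenbeck s (\<lambda>y. (f y + e n) powr (1 / p)) x powr q)
      \<longlonglongrightarrow> ornstein_uhlenbeck s (\<lambda>y. f y powr (1 / p)) x powr q"
  proof (rule AE_I2)
    fix x :: 'a
    let ?c = "\<lambda>y. exp (- s) *\<^sub>R x + sqrt (1 - exp (- 2 * s)) *\<^sub>R y"
    have "(\<lambda>n. \<integral>y. fe n (?c y) \<partial>borel_gaussian) \<longlonglongrightarrow> (\<integral>y. f (?c y) powr (1 / p) \<partial>borel_gaussian)"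
    proof (rule integral_dominated_convergence[where w="\<lambda>_. (M + 1) powr (1 / p)"])
      show "AE y in borel_gaussian. (\<lambda>n. fe n (?c y)) \<longlonglongrightarrow> f (?c y) powr (1 / p)"
      proof (rule AE_I2)
        fix y
        have "(\<lambda>n. f (?c y) + e n) \<longlonglongrightarrow> f (?c y) + 0" by (intro tendsto_intros e(1))
        then show "(\<lambda>n. fe n (?c y)) \<longlonglongrightarrow> f (?c y) powr (1 / p)"
          unfolding fe_def using f(1) e(2) p by (intro tendsto_powr' tendsto_const) auto
      qed
      show "AE y in borel_gaussian. norm (fe n (?c y)) \<le> (M + 1) powr (1 / p)" for n
        using fe by auto
    qed simp_all
    then have "(\<lambda>n. ornstein_uhlenbeck s (fe n) x) \<longlonglongrightarrow> ornstein_uhlenbeck s (\<lambda>y. f y powr (1 / p)) x"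
      by (simp add: ornstein_uhlenbeck_eq_heat heat_def)
    then have "(\<lambda>n. ornstein_uhlenbeck s (fe n) x powr q) \<longlonglongrightarrow> ornstein_uhlenbeck s (\<lambda>y. f y powr (1 / p)) x powr q"
      using q ou by (intro tendsto_powr' tendsto_const) auto
    then show "(\<lambda>n. ornstein_uhlenbeck s (\<lambda>y. (f y + e n) powr (1 / p)) x powr q)
      \<longlonglongrightarrow> ornstein_uhlenbeck s (\<lambda>y. f y powr (1 / p)) x powr q"
      by (simp add: fe_def[abs_def])
  qed
  show "AE x in borel_gaussian. norm (ornstein_uhlenbeck s (\<lambda>y. (f y + e n) powr (1 / p)) x powr q)
      \<le> ((M + 1) powr (1 / p)) powr q" for n
    using ou q by (auto simp: fe_def[abs_def] intro!: powr_mono2)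
qed simp_all

theorem corollary2:
  fixes p q s :: real
    and g :: "real ^ 'd \<Rightarrow> real"
    and u :: "real \<Rightarrow> real ^ 'd \<Rightarrow> real"
    and Q :: "real \<Rightarrow> real"
  assumes "1 < p" and "p < q"
    and "0 < s" and "exp (2 * s) = (q - 1) / (p - 1)"
    and "g \<in> borel_measurable lebesgue"
    and "\<And>x. 0 \<le> g x"
    and "bounded (range g)"
    and "compact (closure {x. g x \<noteq> 0})"
    and "\<not> (AE x in lebesgue. g x = 0)"
    and "\<And>t x. 0 < t \<Longrightarrow> u t x = ornstein_uhlenbeck t g x"
    and "\<And>t. 0 < t \<Longrightarrow>
      Q t = (\<integral>x. (ornstein_uhlenbeck s (\<lambda>y. u t y powr (1 / p)) x) powr q \<partial>gaussian)"
  shows "(\<forall>t>0. 0 < Q t) \<and> mono_on {0<..} Q"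
proof -
  obtain M where "\<And>x. \<bar>g x\<bar> \<le> M"
    using \<open>bounded (range g)\<close> unfolding bounded_iff by auto
  then have "\<And>x. g x \<le> M" by (simp add: abs_le_iff)
  \<comment> \<open>From here on \<open>g'\<close> replaces \<open>g\<close>; for t > 0 this changes
    \<open>u t\<close> at no point.\<close>
  then obtain g' where [measurable]: "g' \<in> borel_measurable borel"
    and g': "\<And>x. 0 \<le> g' x" "\<And>x. g' x \<le> M" and ae: "AE x in lborel. g x = g' x"
    using borel_version[OF assms(5,6), of M] by metis
  have gabs: "\<bar>g' x\<bar> \<le> M" for x using g'[of x] by simp
  have nz: "\<not> (AE x in lborel. g' x = 0)"
  proof
    assume "AE x in lborel. g' x = 0"
    with ae have "AE x in lborel. g x = 0" by eventually_elim simp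
    then have "AE x in lebesgue. g x = 0" by (rule AE_completion)
    with assms(9) show False by simp
  qed
  have u: "u t = ornstein_uhlenbeck t g'" if "0 < t" for t
    using assms(10)[OF that] ornstein_uhlenbeck_cong_AE[OF assms(5) _ ae that] by (simp add: fun_eq_iff)
  have um [measurable]: "u t \<in> borel_measurable borel" if "0 < t" for t
    unfolding u[OF that] by measurable
  have u0: "0 < u t x" if "0 < t" for t x
    unfolding u[OF that] using heat_pos[OF _ g' nz one_minus_exp_bounds(1)[OF that]]
    by (simp add: ornstein_uhlenbeck_eq_heat)
  have uM: "u t x \<le> M" if "0 < t" for t x
    unfolding u[OF that] by (rule ornstein_uhlenbeck_le(1)[OF _ g']) measurable
  define L where "L = M powr (1 / p)"
  have Q: "Q t = (\<integral>x. ornstein_uhlenbeck s (\<lambda>y. u t y powr (1 / p)) x powr q \<partial>borel_gaussian)" if "0 < t" for t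
  proof -
    note [measurable] = um[OF that]
    show ?thesis
      unfolding assms(11)[OF that] by (rule integral_gaussian_borel) measurable
  qed
  have "0 < Q t" if t: "0 < t" for t
  proof -
    note [measurable] = um[OF that]
    have v: "0 < u t y powr (1 / p)" "u t y powr (1 / p) \<le> L" for y
      using u0[OF t, of y] uM[OF t, of y] assms(1) by (auto simp: L_def intro!: powr_mono2)
    have ou: "0 < ornstein_uhlenbeck s (\<lambda>y. u t y powr (1 / p)) x" for x
    proof -
      have m: "(\<lambda>y. u t y powr (1 / p)) \<in> borel_measurable borel" by measurable
      show ?thesis
        unfolding ornstein_uhlenbeck_eq_heat[OF m] heat_def
        by (rule integral_borel_gaussian_pos, rule integrable_heat[OF m, where M=L])
           (use v in \<open>simp_all add: less_imp_neq[symmetric]\<close>)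
    qed
    have ouL: "ornstein_uhlenbeck s (\<lambda>y. u t y powr (1 / p)) x \<le> L" for x
      by (rule ornstein_uhlenbeck_le(1)[OF _ _ v(2), where m=0]) simp_all
    show ?thesis
      unfolding Q[OF t]
    proof (rule integral_borel_gaussian_pos)
      show "integrable borel_gaussian (\<lambda>x. ornstein_uhlenbeck s (\<lambda>y. u t y powr (1 / p)) x powr q)"
      proof (rule integrable_borel_gaussian_bounded[where M="L powr q"])
        show "\<bar>ornstein_uhlenbeck s (\<lambda>y. u t y powr (1 / p)) x powr q\<bar> \<le> L powr q" for x
          using ou[of x] ouL[of x] assms(1,2) by (auto intro!: powr_mono2)
      qed measurable
    qed (use ou in \<open>auto simp: less_imp_neq[symmetric]\<close>)
  qed
  moreover have "Q t \<le> Q t'" if t: "0 < t" and tt: "t \<le> t'" for t t'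
  proof (cases "t = t'")
    case False
    define h where "h = t' - t"
    have h: "0 < h" "t' = h + t" using tt False by (auto simp: h_def)
    have t': "0 < t'" using t tt by linarith
    note [measurable] = um[OF t] um[OF t']
    \<comment> \<open>\<open>u t\<close> is positive but need not be bounded away from 0, as the
      pointwise inequality requires; the shift provides the lower bound.\<close>
    define e where "e n = inverse (real (Suc n))" for n
    have e: "e \<longlonglongrightarrow> 0" "\<And>n. 0 < e n" "\<And>n. 0 \<le> e n" "\<And>n. e n \<le> 1"
      unfolding e_def by (rule LIMSEQ_inverse_real_of_nat) (auto simp: field_simps)
    define Qe where "Qe t n = (\<integral>x. ornstein_uhlenbeck s (\<lambda>y. (u t y + e n) powr (1 / p)) x powr q \<partial>borel_gaussian)" for t n
    have lim: "Qe r \<longlonglongrightarrow> Q r" if r: "0 < r" for r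
      unfolding Qe_def[abs_def] Q[OF r]
      by (rule ornstein_uhlenbeck_powr_tendsto[OF um[OF r] less_imp_le[OF u0[OF r]] uM[OF r]])
         (use e assms(1,2) in auto)
    have "Qe t n \<le> Qe t' n" for n
    proof -
      define v where "v y = u t y + e n" for y
      define \<phi> where "\<phi> y = ornstein_uhlenbeck s (\<lambda>z. v z powr (1 / p)) y powr q" for y
      define \<psi> where "\<psi> y = ornstein_uhlenbeck s (\<lambda>z. ornstein_uhlenbeck h v z powr (1 / p)) y powr q" for y
      have vb: "e n \<le> v y" "v y \<le> M + 1" for y
        using u0[OF t, of y] uM[OF t, of y] e(4)[of n] by (auto simp: v_def)
      have [measurable]: "v \<in> borel_measurable borel" unfolding v_def by measurable
      have [measurable]: "\<phi> \<in> borel_measurable borel" "\<psi> \<in> borel_measurable borel"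
        unfolding \<phi>_def \<psi>_def by measurable
      have vcont: "continuous_on UNIV v"
        unfolding v_def u[OF t]
        by (intro continuous_intros ornstein_uhlenbeck_continuous[OF _ gabs t]) measurable
      define B where "B = ((M + 1) powr (1 / p)) powr q"
      have bnd: "\<bar>ornstein_uhlenbeck s (\<lambda>z. w z powr (1 / p)) y powr q\<bar> \<le> B"
        if [measurable]: "w \<in> borel_measurable borel" and w: "\<And>y. e n \<le> w y" "\<And>y. w y \<le> M + 1" for w :: "real ^ 'd \<Rightarrow> real" and y
      proof -
        have "0 \<le> w z powr (1 / p)" "w z powr (1 / p) \<le> (M + 1) powr (1 / p)" for z
          using w[of z] e(2)[of n] assms(1) by (auto intro!: powr_mono2)
        from ornstein_uhlenbeck_le[OF _ this, where s=s and x=y] show ?thesis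
          unfolding B_def using assms(1,2) by (auto intro!: powr_mono2)
      qed
      have \<phi>b: "\<bar>\<phi> y\<bar> \<le> B" for y
        unfolding \<phi>_def by (rule bnd) (use vb in auto)
      have \<psi>b: "\<bar>\<psi> y\<bar> \<le> B" for y
        unfolding \<psi>_def by (rule bnd) (use ornstein_uhlenbeck_le[OF \<open>v \<in> _\<close> vb] in auto)
      \<comment> \<open>The semigroup fixes constants, so evolving the shifted function for time h
        gives \<open>u t'\<close> with the same shift.\<close>
      have vh: "ornstein_uhlenbeck h v z = u t' z + e n" for z
      proof -
        have "integrable borel_gaussian (\<lambda>y. u t (exp (- h) *\<^sub>R z + sqrt (1 - exp (- 2 * h)) *\<^sub>R y))"
          by (rule integrable_heat[where M=M]) (use less_imp_le[OF u0[OF t]] uM[OF t] in \<open>simp_all add: um t\<close>)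
        then have "ornstein_uhlenbeck h v z = ornstein_uhlenbeck h (u t) z + e n"
          using borel_gaussian.prob_space[where 'a="real ^ 'd"]
          by (simp add: ornstein_uhlenbeck_eq_heat heat_def v_def)
        also have "ornstein_uhlenbeck h (u t) z = u t' z"
          unfolding u[OF t] u[OF t'] unfolding h(2) by (rule ornstein_uhlenbeck_compose[OF _ gabs h(1) t]) measurable
        finally show ?thesis .
      qed
      have "Qe t n = (\<integral>x. \<phi> x \<partial>borel_gaussian)"
        by (simp add: Qe_def \<phi>_def v_def)
      \<comment> \<open>Invariance inserts e^(hL) without changing the integral, which brings the
        integrand into the form of the pointwise inequality.\<close>
      also have "\<dots> = (\<integral>x. ornstein_uhlenbeck h \<phi> x \<partial>borel_gaussian)"
        by (rule integral_ornstein_uhlenbeck[OF _ \<phi>b h(1), symmetric]) measurable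
      also have "\<dots> \<le> (\<integral>x. \<psi> x \<partial>borel_gaussian)"
      proof (rule Bochner_Integration.integral_mono)
        show "ornstein_uhlenbeck h \<phi> x \<le> \<psi> x" for x
          unfolding \<phi>_def[abs_def] \<psi>_def
          by (rule ornstein_uhlenbeck_supersolution[OF assms(1-4) h(1) vcont e(2) vb])
        have "- B \<le> \<phi> y" "\<phi> y \<le> B" for y using \<phi>b[of y] by linarith+
        from ornstein_uhlenbeck_le[OF \<open>\<phi> \<in> borel_measurable borel\<close> this]
        have "\<bar>ornstein_uhlenbeck h \<phi> x\<bar> \<le> B" for x
          unfolding abs_le_iff by (simp add: minus_le_iff)
        then show "integrable borel_gaussian (ornstein_uhlenbeck h \<phi>)"
          by (rule integrable_borel_gaussian_bounded[rotated]) measurable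
        show "integrable borel_gaussian \<psi>"
          by (rule integrable_borel_gaussian_bounded[OF _ \<psi>b]) measurable
      qed
      also have "\<dots> = Qe t' n"
        by (simp add: Qe_def \<psi>_def vh)
      finally show ?thesis .
    qed
    then show ?thesis
      by (intro LIMSEQ_le[OF lim[OF t] lim[OF t']]) auto
  qed simp
  ultimately show ?thesis
    by (auto intro!: mono_onI)
qed

end
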